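(* Let $N\ge 2$ be an integer and consider the bipartite quantum system $\mathcal{H}=\mathcal{H}_1\otimes\mathcal{H}_2$ with $\dim_{\mathbb{C}}\mathcal{H}_1=2$ and $\dim_{\mathbb{C}}\mathcal{H}_2=N$ (so $d=\dim_{\mathbb{C}}\mathcal{H}=2N$). Then $2N=L_c=L_{\rm crit}$. Equivalently, $\dim \mathcal{S}'_{2N}=4N^2-1$.
   Context: Let $\mathcal{H}=\mathcal{H}_1\otimes\cdots\otimes\mathcal{H}_n$ ($n>1$) be a tensor product of finite-dimensional complex Hilbert spaces with $d_i=\dim\mathcal{H}_i>1$, and let $d=\prod_i d_i$. Let $H$ be the real vector space (of dimension $d^2$) of Hermitian operators on $\mathcal{H}$, and $H_1\subset H$ the affine hyperplane of operators of trace $1$. A product vector is a nonzero vector of the form $|x_1\rangle\otimes\cdots\otimes|x_n\rangle$ with $|x_i\rangle\in\mathcal{H}_i$. A (non-normalized) state is a nonzero positive semidefinite operator on $\mathcal{H}$. It is separable if it can be written as $\rho=\sum_{k=1}^{l}|z_k\rangle\langle z_k|$ with all $|z_k\rangle$ product vectors; the length $L(\rho)$ is the smallest $l$ over all such decompositions. $\mathcal{S}\subset H_1$ denotes the set of separable states of trace $1$, and for a positive integer $r$, $\mathcal{S}'_r=\{\rho\in\mathcal{S}: L(\rho)\le r\}$. The sets $\mathcal{S}'_r$ are semialgebraic subsets of $H_1$, and $\dim$ denotes real dimension as a semialgebraic set. The critical length $L_{\rm crit}$ is the smallest positive integer $r$ such that $\dim\mathcal{S}'_r=d^2-1$ (equivalently,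 such that $\mathcal{S}'_r$ has positive volume in $H_1$). The integer $L_c$ is defined by $L_c=\left\lceil \dfrac{d^2}{1+2\sum_{i=1}^n(d_i-1)}\right\rceil$. *)

theory Defs
  imports "HOL-Analysis.Analysis" "HOL-Algebra.QuotRing" "HOL-Library.Extended_Nat"
begin

section \<open>Dimension of semialgebraic sets\<close>

text \<open>
  Following Bochnak, Coste and Roy (Real Algebraic Geometry, Section 2.8), the dimension of a
  semialgebraic set \<open>A\<close> is the Krull dimension of the ring \<open>\<real>[X] / I(A)\<close>, where \<open>I(A)\<close> is
  the ideal of the polynomials that vanish on \<open>A\<close>.  On a Euclidean space, \<open>\<real>[X]\<close> is the
  ring of real polynomial functions; \<^term>\<open>bounded_linear\<close> in the definition of
  \<^const>\<open>real_polynomial_function\<close> is real linearity, so on a complex coordinate space the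
  variables are the real and imaginary parts of the coordinates.  Replacing the ambient space by
  an affine subspace that contains \<open>A\<close> does not change \<open>\<real>[X] / I(A)\<close> up to isomorphism.
\<close>

definition poly_fun_ring :: "('a::euclidean_space \<Rightarrow> real) ring" where
  "poly_fun_ring =
    \<lparr>carrier = {f. real_polynomial_function f},
     mult = (\<lambda>f g x. f x * g x), one = (\<lambda>x. 1),
     zero = (\<lambda>x. 0), add = (\<lambda>f g x. f x + g x)\<rparr>"

definition vanishing_ideal :: "'a::euclidean_space set \<Rightarrow> ('a \<Rightarrow> real) set" where
  "vanishing_ideal A = {f \<in> carrier poly_fun_ring. \<forall>x\<in>A. f x = 0}"

text \<open>The zero ring has no prime ideal and gets the value 0 here; for
  \<open>\<real>[X] / I(A)\<close> this happens only if \<open>A\<close> is empty.\<close>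

definition krull_dim :: "('a, 'b) ring_scheme \<Rightarrow> enat" where
  "krull_dim R = Sup {enat k | k. \<exists>P. (\<forall>i\<le>k. primeideal (P i) R) \<and> (\<forall>i<k. P i \<subset> P (Suc i))}"

definition semialg_dim :: "'a::euclidean_space set \<Rightarrow> enat" where
  "semialg_dim A = krull_dim (poly_fun_ring Quot vanishing_ideal A)"

lemma poly_fun_ring_cring: "cring (poly_fun_ring :: ('a::euclidean_space \<Rightarrow> real) ring)"
proof (rule cringI)
  let ?R = "poly_fun_ring :: ('a \<Rightarrow> real) ring"
  show "abelian_group ?R"
  proof (rule abelian_groupI)
    fix f assume "f \<in> carrier ?R"
    then have "real_polynomial_function (\<lambda>x. - f x)"
      by (simp add: poly_fun_ring_def real_polynomial_function_minus)
    then show "\<exists>g\<in>carrier ?R. g \<oplus>\<^bsub>?R\<^esub> f = \<zero>\<^bsub>?R\<^esub>"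
      by (intro bexI[of _ "\<lambda>x. - f x"]) (auto simp: poly_fun_ring_def)
  qed (auto simp: poly_fun_ring_def algebra_simps)
  show "comm_monoid ?R"
    by (rule comm_monoidI) (auto simp: poly_fun_ring_def algebra_simps)
qed (auto simp: poly_fun_ring_def algebra_simps)

lemma vanishing_ideal_ideal:
  "ideal (vanishing_ideal A) (poly_fun_ring :: ('a::euclidean_space \<Rightarrow> real) ring)"
proof -
  let ?R = "poly_fun_ring :: ('a \<Rightarrow> real) ring"
  interpret cring ?R by (rule poly_fun_ring_cring)
  have inv: "f \<in> carrier ?R \<Longrightarrow> \<ominus>\<^bsub>?R\<^esub> f = (\<lambda>x. - f x)" for f
    by (rule minus_equality)
      (auto simp: poly_fun_ring_def real_polynomial_function_minus)
  show ?thesis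
  proof (rule idealI)
    show "subgroup (vanishing_ideal A) (add_monoid ?R)"
    proof (rule add.subgroupI)
      show "vanishing_ideal A \<noteq> {}"
        using zero_closed by (auto simp: vanishing_ideal_def poly_fun_ring_def)
      show "\<ominus>\<^bsub>?R\<^esub> f \<in> vanishing_ideal A" if "f \<in> vanishing_ideal A" for f
        using that inv[of f] a_inv_closed[of f] by (auto simp: vanishing_ideal_def)
    qed (auto simp: vanishing_ideal_def poly_fun_ring_def)
  qed (auto simp: vanishing_ideal_def poly_fun_ring_def intro: ring_axioms[unfolded poly_fun_ring_def])
qed


section \<open>Separable states of a bipartite system\<close>

text \<open>
  The Hilbert spaces are the coordinate spaces indexed by finite types \<open>'a\<close> and \<open>'b\<close>, and
  their tensor product is the coordinate space indexed by \<open>'a \<times> 'b\<close>.  Operators are matrices.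
\<close>

type_synonym ('a, 'b) bivec = "complex ^ ('a \<times> 'b)"
type_synonym ('a, 'b) biop = "complex ^ ('a \<times> 'b) ^ ('a \<times> 'b)"

definition tensor_vec :: "complex ^ 'a \<Rightarrow> complex ^ 'b \<Rightarrow> ('a::finite, 'b::finite) bivec" where
  "tensor_vec x y = (\<chi> p. x $ fst p * y $ snd p)"

definition product_vector :: "('a::finite, 'b::finite) bivec \<Rightarrow> bool" where
  "product_vector z \<longleftrightarrow> z \<noteq> 0 \<and> (\<exists>x y. z = tensor_vec x y)"

definition ket_bra :: "complex ^ 'c \<Rightarrow> complex ^ 'c ^ 'c" where
  "ket_bra z = (\<chi> p q. z $ p * cnj (z $ q))"

definition hermitian :: "complex ^ 'c ^ 'c \<Rightarrow> bool" where
  "hermitian A \<longleftrightarrow> (\<forall>p q. A $ p $ q = cnj (A $ q $ p))"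

definition pos_semidef :: "complex ^ 'c ^ ('c::finite) \<Rightarrow> bool" where
  "pos_semidef A \<longleftrightarrow> hermitian A \<and> (\<forall>v. 0 \<le> Re (\<Sum>p\<in>UNIV. cnj (v $ p) * (A *v v) $ p))"

definition is_state :: "complex ^ 'c ^ ('c::finite) \<Rightarrow> bool" where
  "is_state \<rho> \<longleftrightarrow> \<rho> \<noteq> 0 \<and> pos_semidef \<rho>"

definition product_decomp :: "('a::finite, 'b::finite) biop \<Rightarrow> nat \<Rightarrow> bool" where
  "product_decomp \<rho> l \<longleftrightarrow>
     (\<exists>z. (\<forall>k<l. product_vector (z k)) \<and> \<rho> = (\<Sum>k<l. ket_bra (z k)))"

definition separable :: "('a::finite, 'b::finite) biop \<Rightarrow> bool" where
  "separable \<rho> \<longleftrightarrow> is_state \<rho> \<and> (\<exists>l. product_decomp \<rho> l)"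

definition state_length :: "('a::finite, 'b::finite) biop \<Rightarrow> nat" where
  "state_length \<rho> = (LEAST l. product_decomp \<rho> l)"

definition sep_states :: "('a::finite, 'b::finite) biop set" where
  "sep_states = {\<rho>. separable \<rho> \<and> trace \<rho> = 1}"

definition sep_states_le :: "nat \<Rightarrow> ('a::finite, 'b::finite) biop set" where
  "sep_states_le r = {\<rho> \<in> sep_states. state_length \<rho> \<le> r}"

text \<open>The critical length; the total dimension \<open>d\<close> is \<^term>\<open>CARD('a \<times> 'b)\<close>.\<close>

definition L_crit :: "'a::finite itself \<Rightarrow> 'b::finite itself \<Rightarrow> nat" where
  "L_crit _ _ = (LEAST r. 0 < r \<and>
     semialg_dim (sep_states_le r :: ('a, 'b) biop set) = enat (CARD('a \<times> 'b) ^ 2 - 1))"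

text \<open>The argument is the list of the local dimensions \<open>d\<^sub>1, \<dots>, d\<^sub>n\<close>.\<close>

definition L_c :: "nat list \<Rightarrow> nat" where
  "L_c ds = nat \<lceil>real (prod_list ds) ^ 2 / (1 + 2 * (\<Sum>d\<leftarrow>ds. real d - 1))\<rceil>"

end

theory Submission
  imports Defs
begin

text \<open>
  Both inequalities concern the parametrisation of \<open>\<S>'\<^sub>r\<close> by \<open>r\<close> product vectors.  A projector onto
  a product vector, up to a positive factor, depends on \<open>2 N + 1\<close> real parameters, and the trace
  condition removes one of the \<open>r (2 N + 1)\<close>, so the coordinate ring of \<open>\<S>'\<^sub>r\<close> contains at most
  \<open>r (2 N + 1) - 1\<close> algebraically independent elements, which bounds the length of its chains of
  primes.  For \<open>r < 2 N\<close> this is less than \<open>4 N\<^sup>2 - 1\<close>.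

  For \<open>r = 2 N\<close> the parametrisation is a submersion onto the Hermitian matrices at the products
  \<open>(1, u) \<otimes> e\<^sub>j\<close> with \<open>u \<in> {p\<^sub>j, 2 \<i> p\<^sub>j}\<close>, where \<open>p\<^sub>1, \<dots>, p\<^sub>N > 0\<close> are distinct: a Hermitian
  matrix orthogonal to all tangent spaces vanishes, since its entries over \<open>{i, j}\<close> are
  the coefficients of a circle equation that the four non-concyclic points \<open>p\<^sub>i, p\<^sub>j, 2 \<i> p\<^sub>i, 2 \<i> p\<^sub>j\<close>
  satisfy.  Hence \<open>\<S>'\<^sub>2\<^sub>N\<close> contains a nonempty relatively open subset of the space of Hermitian
  matrices of trace 1, and it has the same vanishing ideal as this affine space.
\<close>

section \<open>Dimension through chains of prime ideals\<close>

lemma (in ideal) carrier_quot: "carrier (R Quot I) = (+>) I ` carrier R"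
  unfolding FactRing_def A_RCOSETS_def' by auto

text \<open>As \<open>I \<subseteq> P\<close>, whether a coset lies in the image can be tested on
  any representative: if \<open>I +> a = I +> b\<close> with \<open>b \<in> P\<close>, then
  \<open>a\<close> differs from \<open>b\<close> by an element of \<open>I\<close> and lies in
  \<open>P\<close>. Primality then passes to the quotient.\<close>

lemma (in ideal) primeideal_image_rcos:
  assumes "cring R" and P: "primeideal P R" and IP: "I \<subseteq> P"
  shows "primeideal ((+>) I ` P) (R Quot I)"
proof (rule primeidealI)
  interpret cring R by fact
  interpret P: primeideal P R by fact
  interpret h: ring_hom_cring R "R Quot I" "(+>) I"
    by (rule rcos_ring_hom_cring) fact
  have mem: "a \<in> P" if a: "a \<in> carrier R" "I +> a \<in> (+>) I ` P" for a
  proof -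
    obtain b where b: "b \<in> P" "I +> a = I +> b" using a(2) by blast
    then have "a \<in> I +> b" using a_rcos_self[of a] a by simp
    then obtain i where "i \<in> I" "a = i \<oplus> b"
      unfolding a_r_coset_def' by auto
    then show ?thesis using b IP P.a_closed by auto
  qed
  show "ideal ((+>) I ` P) (R Quot I)"
    using ring_ideal_imp_quot_ideal[OF is_ideal P.is_ideal] .
  show "cring (R Quot I)" by (rule quotient_is_cring) fact
  show "carrier (R Quot I) \<noteq> (+>) I ` P"
  proof
    assume eq: "carrier (R Quot I) = (+>) I ` P"
    have "I +> \<one> \<in> carrier (R Quot I)" by simp
    with eq mem[of \<one>] P.one_imp_carrier P.I_notcarr show False by auto
  qed
  fix A B assume AB: "A \<in> carrier (R Quot I)" "B \<in> carrier (R Quot I)"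
    "A \<otimes>\<^bsub>R Quot I\<^esub> B \<in> (+>) I ` P"
  then obtain a b where ab: "a \<in> carrier R" "b \<in> carrier R" "A = I +> a" "B = I +> b"
    unfolding carrier_quot by blast
  with AB have "I +> (a \<otimes> b) \<in> (+>) I ` P" by simp
  with ab mem[of "a \<otimes> b"] have "a \<otimes> b \<in> P" by auto
  with ab P.I_prime have "a \<in> P \<or> b \<in> P" by auto
  with ab show "A \<in> (+>) I ` P \<or> B \<in> (+>) I ` P" by auto
qed

text \<open>The correspondence theorem: preimages and images under the quotient map carry strict
  chains of primes to strict chains, and the primes met in \<open>R\<close> are those containing
  \<open>I\<close>.\<close>

lemma (in ideal) krull_dim_quot:
  assumes "cring R"
  shows "krull_dim (R Quot I) =
    Sup {enat k | k. \<exists>P. (\<forall>i\<le>k. primeideal (P i) R \<and> I \<subseteq> P i) \<and> (\<forall>i<k. P i \<subset> P (Suc i))}"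
proof -
  interpret cring R by fact
  interpret h: ring_hom_cring R "R Quot I" "(+>) I"
    by (rule rcos_ring_hom_cring) fact
  have "(\<exists>Q. (\<forall>i\<le>k. primeideal (Q i) (R Quot I)) \<and> (\<forall>i<k. Q i \<subset> Q (Suc i))) \<longleftrightarrow>
    (\<exists>P. (\<forall>i\<le>k. primeideal (P i) R \<and> I \<subseteq> P i) \<and> (\<forall>i<k. P i \<subset> P (Suc i)))" (is "?L \<longleftrightarrow> ?R") for k
  proof
    assume ?L
    then obtain Q where Q: "\<And>i. i \<le> k \<Longrightarrow> primeideal (Q i) (R Quot I)" "\<And>i. i<k \<Longrightarrow> Q i \<subset> Q (Suc i)"
      by auto
    define P where "P i = {r \<in> carrier R. I +> r \<in> Q i}" for i
    have "primeideal (P i) R" if "i \<le> k" for i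
      unfolding P_def by (rule ring_hom_ring.primeideal_vimage[OF rcos_ring_hom_ring is_cring Q(1)[OF that]])
    moreover have "I \<subseteq> P i" if "i \<le> k" for i
    proof
      fix r assume r: "r \<in> I"
      interpret Qi: primeideal "Q i" "R Quot I" by (rule Q(1)[OF that])
      have "I +> r = I" using r by (simp add: a_rcos_const)
      moreover have "\<zero>\<^bsub>R Quot I\<^esub> = I" unfolding FactRing_def by simp
      with Qi.zero_closed have "I \<in> Q i" by metis
      ultimately show "r \<in> P i" using r a_subset by (auto simp: P_def)
    qed
    moreover have "P i \<subset> P (Suc i)" if i: "i < k" for i
    proof -
      interpret Qs: primeideal "Q (Suc i)" "R Quot I" using Q(1)[of "Suc i"] i by simp
      obtain A where A: "A \<in> Q (Suc i)" "A \<notin> Q i" using Q(2)[OF i] by auto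
      then have "A \<in> carrier (R Quot I)" using Qs.a_subset by auto
      then obtain a where "a \<in> carrier R" "A = I +> a" unfolding carrier_quot by blast
      with A have "a \<in> P (Suc i)" "a \<notin> P i" by (auto simp: P_def)
      then show ?thesis using Q(2)[OF i] by (auto simp: P_def)
    qed
    ultimately show ?R by (intro exI[of _ P]) auto
  next
    assume ?R
    then obtain P where P: "\<And>i. i \<le> k \<Longrightarrow> primeideal (P i) R" "\<And>i. i \<le> k \<Longrightarrow> I \<subseteq> P i"
      "\<And>i. i<k \<Longrightarrow> P i \<subset> P (Suc i)" by auto
    have "(+>) I ` P i \<subset> (+>) I ` P (Suc i)" if i: "i < k" for i
    proof -
      interpret Pi: primeideal "P i" R using P(1)[of i] i by simp
      interpret Ps: primeideal "P (Suc i)" R using P(1)[of "Suc i"] i by simp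
      obtain a where a: "a \<in> P (Suc i)" "a \<notin> P i" using P(3)[OF i] by auto
      have "I +> a \<notin> (+>) I ` P i"
      proof
        assume "I +> a \<in> (+>) I ` P i"
        then obtain b where b: "b \<in> P i" "I +> a = I +> b" by blast
        then have "a \<in> I +> b" using a_rcos_self[of a] a Ps.a_subset by auto
        then obtain i' where "i' \<in> I" "a = i' \<oplus> b"
          unfolding a_r_coset_def' by auto
        then show False using b a P(2)[of i] i Pi.a_closed by auto
      qed
      with a P(3)[OF i] show ?thesis by blast
    qed
    with P primeideal_image_rcos[OF is_cring] show ?L
      by (intro exI[of _ "\<lambda>i. (+>) I ` P i"]) auto
  qed
  then show ?thesis unfolding krull_dim_def by simp
qed


section \<open>Algebraic dependence bounds chains of primes\<close>

text \<open>All later arguments use primes of the polynomial ring itself, so no cosets occur after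
  this point.\<close>

lemma semialg_dim_chain:
  "semialg_dim (A :: 'a::euclidean_space set) =
    Sup {enat k | k. \<exists>P. (\<forall>i\<le>k. primeideal (P i) poly_fun_ring \<and> vanishing_ideal A \<subseteq> P i) \<and>
      (\<forall>i<k. P i \<subset> P (Suc i))}"
  unfolding semialg_dim_def
  by (rule ideal.krull_dim_quot[OF vanishing_ideal_ideal poly_fun_ring_cring])

lemma carrier_poly_fun_ring [simp]: "f \<in> carrier poly_fun_ring \<longleftrightarrow> real_polynomial_function f"
  by (simp add: poly_fun_ring_def)

section \<open>Membership in a prime ideal of polynomial functions\<close>

context
  fixes P :: "('a::euclidean_space \<Rightarrow> real) set"
  assumes P: "primeideal P poly_fun_ring"
begin

interpretation P: primeideal P poly_fun_ring by (rule P)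

lemma prime_poly: "f \<in> P \<Longrightarrow> real_polynomial_function f"
  using P.a_subset by auto

lemma prime_mult:
  assumes "(\<lambda>x. f x * g x) \<in> P" "real_polynomial_function f" "real_polynomial_function g"
  shows "f \<in> P \<or> g \<in> P"
  using P.I_prime[of f g] assms by (simp add: poly_fun_ring_def)

lemma prime_mult_closed:
  assumes "f \<in> P" "real_polynomial_function g"
  shows "(\<lambda>x. f x * g x) \<in> P"
  using P.I_r_closed[of f g] assms by (simp add: poly_fun_ring_def)

lemma prime_add_cancel:
  assumes "(\<lambda>x. g x + f x) \<in> P" "f \<in> P"
  shows "g \<in> P"
proof -
  have "(\<lambda>x. f x * (-1)) \<in> P"
    using prime_mult_closed[OF assms(2), of "\<lambda>x. -1"] by auto
  with assms(1) have "(\<lambda>x. g x + f x) \<oplus>\<^bsub>poly_fun_ring\<^esub> (\<lambda>x. f x * (-1)) \<in> P"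
    by (rule additive_subgroup.a_closed[OF P.additive_subgroup_axioms])
  then show ?thesis by (simp add: poly_fun_ring_def)
qed

lemma prime_const:
  assumes "c \<noteq> 0" shows "(\<lambda>x. c) \<notin> P"
proof
  assume "(\<lambda>x. c) \<in> P"
  then have "(\<lambda>x. c * (1 / c)) \<in> P"
    by (rule prime_mult_closed) (rule real_polynomial_function.intros(2))
  with assms have "\<one>\<^bsub>poly_fun_ring\<^esub> \<in> P" by (simp add: poly_fun_ring_def)
  then show False using P.one_imp_carrier P.I_notcarr by auto
qed

lemma prime_power:
  assumes "(\<lambda>x. f x ^ n) \<in> P" "real_polynomial_function f"
  shows "f \<in> P"
  using assms(1)
proof (induction n)
  case 0
  then show ?case using prime_const[of 1] by simp
next
  case (Suc n)
  then show ?case using prime_mult[of f "\<lambda>x. f x ^ n"] assms(2)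
    by (auto intro: real_polynomial_function_power)
qed

end

section \<open>Monomials and strict chains of primes\<close>

text \<open>The base type is arbitrary, so the same monomials serve polynomials on the ambient space
  and coordinate functions on a parameter set. Surplus entries of either list contribute the factor
  1.\<close>

fun fun_monom :: "nat list \<Rightarrow> ('t \<Rightarrow> real) list \<Rightarrow> 't \<Rightarrow> real" where
  "fun_monom (a # as) (y # ys) t = y t ^ a * fun_monom as ys t"
| "fun_monom _ _ t = 1"

lemma real_polynomial_function_fun_monom:
  "(\<And>y. y \<in> set ys \<Longrightarrow> real_polynomial_function y) \<Longrightarrow> real_polynomial_function (fun_monom as ys)"
proof (induction as ys rule: list_induct2')
  case (4 a as y ys)
  have "fun_monom (a # as) (y # ys) = (\<lambda>t. y t ^ a * fun_monom as ys t)" by (rule ext) simp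
  with 4 show ?case
    by (simp add: real_polynomial_function.intros(4) real_polynomial_function_power)
qed (simp_all add: ext[of "fun_monom _ _" "\<lambda>_. 1"] real_polynomial_function.intros(2))

text \<open>If \<open>e\<close> is the lowest exponent of the first element \<open>x\<close> in a polynomial relation, then the
  relation is \<open>x ^ e * (g + x * h)\<close> with \<open>g\<close> free of \<open>x\<close>.  As \<open>x\<close> lies in \<open>P 1\<close> but not
  in \<open>P 0\<close>, membership in \<open>P 0\<close> would give \<open>g \<in> P 1\<close>, a relation with one element less.\<close>

lemma prime_chain_monom:
  fixes P :: "nat \<Rightarrow> ('a::euclidean_space \<Rightarrow> real) set"
  assumes "\<And>i. i \<le> length xs \<Longrightarrow> primeideal (P i) poly_fun_ring"
    and "\<And>i. i < length xs \<Longrightarrow> P i \<subset> P (Suc i)"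
    and "\<And>i. i < length xs \<Longrightarrow> xs ! i \<in> P (Suc i) - P i"
    and "finite F" "\<And>\<alpha>. \<alpha> \<in> F \<Longrightarrow> length \<alpha> = length xs" "\<alpha>0 \<in> F" "c \<alpha>0 \<noteq> 0"
  shows "(\<lambda>v. \<Sum>\<alpha>\<in>F. c \<alpha> * fun_monom \<alpha> xs v) \<notin> P 0"
  using assms
proof (induction xs arbitrary: P F c \<alpha>0)
  case Nil
  then have "F = {[]}" by auto
  moreover from Nil have "c [] \<noteq> 0" by auto
  ultimately show ?case using prime_const[of "P 0" "c []"] Nil(1)[of 0] by simp
next
  case (Cons x xs)
  note prime = Cons.prems(1)
  have P0: "primeideal (P 0) poly_fun_ring" and P1: "primeideal (P 1) poly_fun_ring"
    using prime[of 0] prime[of 1] by auto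
  have x: "x \<in> P 1" "x \<notin> P 0" using Cons.prems(3)[of 0] by auto
  have px: "real_polynomial_function x" using prime_poly[OF P1 x(1)] .
  have pxs: "real_polynomial_function y" if y: "y \<in> set xs" for y
  proof -
    obtain i where i: "i < length xs" "xs ! i = y" using y by (auto simp: in_set_conv_nth)
    then have "y \<in> P (Suc (Suc i))" using Cons.prems(3)[of "Suc i"] by auto
    then show ?thesis using prime_poly[OF prime[of "Suc (Suc i)"]] i by auto
  qed
  note pm = real_polynomial_function_fun_monom[of xs, OF pxs]
  \<comment> \<open>Zero coefficients are discarded, so that a term with the lowest exponent
    \<open>e\<close> is a nonzero term of \<open>g\<close>.\<close>
  define F' where "F' = {\<alpha>\<in>F. c \<alpha> \<noteq> 0}"
  have F': "finite F'" "F' \<noteq> {}" using Cons.prems by (auto simp: F'_def)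
  have len: "length \<alpha> = Suc (length xs)" if "\<alpha> \<in> F'" for \<alpha>
    using Cons.prems(5)[of \<alpha>] that by (simp add: F'_def)
  define e where "e = Min (hd ` F')"
  have e_le: "e \<le> hd \<alpha>" if "\<alpha> \<in> F'" for \<alpha> using that F' by (simp add: e_def)
  have "e \<in> hd ` F'" unfolding e_def using F' by (intro Min_in) auto
  then obtain \<alpha>1 where \<alpha>1: "\<alpha>1 \<in> F'" "hd \<alpha>1 = e" by auto
  then have \<alpha>1': "\<alpha>1 = e # tl \<alpha>1" using len[of \<alpha>1] by (cases \<alpha>1) auto
  define G where "G = {\<beta>. e # \<beta> \<in> F'}"
  have inj: "inj_on (Cons e) G" by simp
  have GF: "Cons e ` G \<subseteq> F'" by (auto simp: G_def)
  have finG: "finite G" using finite_imageD[OF finite_subset[OF GF F'(1)] inj] .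
  define g where "g v = (\<Sum>\<beta>\<in>G. c (e # \<beta>) * fun_monom \<beta> xs v)" for v
  define h where "h v = (\<Sum>\<alpha>\<in>F' - Cons e ` G. c \<alpha> * (x v ^ (hd \<alpha> - e - 1) * fun_monom (tl \<alpha>) xs v))" for v
  have "(\<Sum>\<alpha>\<in>F. c \<alpha> * fun_monom \<alpha> (x # xs) v) = x v ^ e * (g v + x v * h v)" for v
  proof -
    have "(\<Sum>\<alpha>\<in>F. c \<alpha> * fun_monom \<alpha> (x # xs) v) = (\<Sum>\<alpha>\<in>F'. c \<alpha> * fun_monom \<alpha> (x # xs) v)"
      using Cons.prems(4) by (intro sum.mono_neutral_right) (auto simp: F'_def)
    also have "\<dots> = (\<Sum>\<alpha>\<in>F' - Cons e ` G. c \<alpha> * fun_monom \<alpha> (x # xs) v) +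
        (\<Sum>\<alpha>\<in>Cons e ` G. c \<alpha> * fun_monom \<alpha> (x # xs) v)"
      by (rule sum.subset_diff[OF GF F'(1)])
    also have "(\<Sum>\<alpha>\<in>Cons e ` G. c \<alpha> * fun_monom \<alpha> (x # xs) v) = x v ^ e * g v"
      by (simp add: sum.reindex g_def sum_distrib_left mult_ac)
    also have "(\<Sum>\<alpha>\<in>F' - Cons e ` G. c \<alpha> * fun_monom \<alpha> (x # xs) v) = x v ^ e * (x v * h v)"
      unfolding h_def sum_distrib_left
    proof (rule sum.cong[OF refl])
      fix \<alpha> assume a: "\<alpha> \<in> F' - Cons e ` G"
      then obtain b \<beta> where b: "\<alpha> = b # \<beta>" using len[of \<alpha>] by (cases \<alpha>) auto
      with a have "b \<noteq> e" by (auto simp: G_def)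
      with e_le[of \<alpha>] a b have "b > e" by auto
      then have "x v ^ b = x v ^ e * (x v * x v ^ (b - e - 1))"
        by (simp flip: power_Suc power_add)
      then show "c \<alpha> * fun_monom \<alpha> (x # xs) v =
          x v ^ e * (x v * (c \<alpha> * (x v ^ (hd \<alpha> - e - 1) * fun_monom (tl \<alpha>) xs v)))"
        by (simp add: b)
    qed
    finally show ?thesis by (simp add: algebra_simps)
  qed
  then have eq: "(\<lambda>v. \<Sum>\<alpha>\<in>F. c \<alpha> * fun_monom \<alpha> (x # xs) v) = (\<lambda>v. x v ^ e * (g v + x v * h v))"
    by (rule ext)
  have pg: "real_polynomial_function g"
    unfolding g_def[abs_def]
    by (intro real_polynomial_function_sum real_polynomial_function.intros(4) real_polynomial_function.intros(2) pm finG)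
  have ph: "real_polynomial_function h"
    unfolding h_def[abs_def] using F'(1)
    by (intro real_polynomial_function_sum real_polynomial_function.intros(4) real_polynomial_function.intros(2)
        pm real_polynomial_function_power px) auto
  show ?case
  proof
    assume "(\<lambda>v. \<Sum>\<alpha>\<in>F. c \<alpha> * fun_monom \<alpha> (x # xs) v) \<in> P 0"
    then have "(\<lambda>v. x v ^ e * (g v + x v * h v)) \<in> P 0" by (simp add: eq)
    then have "(\<lambda>v. x v ^ e) \<in> P 0 \<or> (\<lambda>v. g v + x v * h v) \<in> P 0"
      by (rule prime_mult[OF P0])
        (intro real_polynomial_function_power px pg ph real_polynomial_function.intros)+
    with prime_power[OF P0 _ px] x(2) have "(\<lambda>v. g v + x v * h v) \<in> P 0" by blast
    then have "(\<lambda>v. g v + x v * h v) \<in> P 1" using Cons.prems(2)[of 0] by auto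
    then have "g \<in> P 1"
      by (rule prime_add_cancel[OF P1]) (rule prime_mult_closed[OF P1 x(1) ph])
    \<comment> \<open>The chain shifted by one starts at \<open>P 1\<close>; the induction
      hypothesis for \<open>xs\<close> rules out the relation \<open>g \<in> P 1\<close>.\<close>
    moreover have "(\<lambda>v. \<Sum>\<beta>\<in>G. c (e # \<beta>) * fun_monom \<beta> xs v) \<notin> (\<lambda>i. P (Suc i)) 0"
    proof (rule Cons.IH)
      show "tl \<alpha>1 \<in> G" using \<alpha>1 \<alpha>1' by (simp add: G_def)
      show "c (e # tl \<alpha>1) \<noteq> 0" using \<alpha>1 \<alpha>1' by (simp add: F'_def)
      show "length \<beta> = length xs" if "\<beta> \<in> G" for \<beta> using that len[of "e # \<beta>"] by (simp add: G_def)
      show "primeideal (P (Suc i)) poly_fun_ring" if "i \<le> length xs" for i using prime[of "Suc i"] that by simp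
      show "P (Suc i) \<subset> P (Suc (Suc i))" if "i < length xs" for i using Cons.prems(2)[of "Suc i"] that by simp
      show "xs ! i \<in> P (Suc (Suc i)) - P (Suc i)" if "i < length xs" for i using Cons.prems(3)[of "Suc i"] that by simp
    qed (rule finG)
    ultimately show False by (simp add: g_def[abs_def])
  qed
qed

section \<open>Linear systems and spans of bounded monomials\<close>

text \<open>Gaussian elimination, by induction on the equations: an unknown \<open>p\<close> with
  nonzero coefficient in equation \<open>j\<close> is used to eliminate that equation, and the
  remaining system still has more unknowns than equations.\<close>

lemma homogeneous_system_nontrivial:
  fixes A :: "'i \<Rightarrow> 'j \<Rightarrow> 'k::field"
  assumes "finite J" "finite I" "card J < card I"
  shows "\<exists>c. (\<exists>i\<in>I. c i \<noteq> 0) \<and> (\<forall>j\<in>J. (\<Sum>i\<in>I. c i * A i j) = 0)"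
  using assms
proof (induction J arbitrary: I A rule: finite_induct)
  case empty
  then obtain i where "i \<in> I" by fastforce
  then show ?case by (intro exI[of _ "\<lambda>_. 1"]) auto
next
  case (insert j J)
  show ?case
  proof (cases "\<exists>p\<in>I. A p j \<noteq> 0")
    case False
    have "card J < card I" using insert by simp
    then obtain c where "\<exists>i\<in>I. c i \<noteq> 0" "\<forall>j\<in>J. (\<Sum>i\<in>I. c i * A i j) = 0"
      using insert.IH[OF insert.prems(1)] by blast
    with False show ?thesis by (intro exI[of _ c]) auto
  next
    case True
    then obtain p where p: "p \<in> I" "A p j \<noteq> 0" by auto
    define B where "B i l = A i l - A i j / A p j * A p l" for i l
    have "card J < card (I - {p})" using insert p by simp
    then obtain c where c: "\<exists>i\<in>I - {p}. c i \<noteq> 0" "\<forall>l\<in>J. (\<Sum>i\<in>I - {p}. c i * B i l) = 0"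
      using insert.IH[of "I - {p}" B] insert.prems(1) by blast
    define s where "s = (\<Sum>i\<in>I - {p}. c i * (A i j / A p j))"
    \<comment> \<open>The value \<open>- s\<close> at \<open>p\<close> solves equation
      \<open>j\<close>; the other equations turn into those with the coefficients
      \<open>B\<close>.\<close>
    define c' where "c' = c(p := - s)"
    have sum: "(\<Sum>i\<in>I. c' i * A i l) = (\<Sum>i\<in>I - {p}. c i * B i l)" for l
    proof -
      have "(\<Sum>i\<in>I. c' i * A i l) = - s * A p l + (\<Sum>i\<in>I - {p}. c i * A i l)"
        using p insert.prems(1) by (subst sum.remove[of _ p]) (auto simp: c'_def intro!: sum.cong)
      also have "\<dots> = (\<Sum>i\<in>I - {p}. c i * B i l)"
        by (simp add: B_def s_def algebra_simps sum_subtractf sum_distrib_left sum_distrib_right)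
      finally show ?thesis .
    qed
    have "(\<Sum>i\<in>I - {p}. c i * B i j) = 0" using p by (simp add: B_def)
    with sum c have "\<forall>l\<in>insert j J. (\<Sum>i\<in>I. c' i * A i l) = 0" by simp
    moreover have "\<exists>i\<in>I. c' i \<noteq> 0" using c by (auto simp: c'_def)
    ultimately show ?thesis by blast
  qed
qed

text \<open>Each exponent is bounded separately, not the total degree, so that the count is a plain
  power.\<close>

definition exps :: "nat \<Rightarrow> nat \<Rightarrow> nat list set" where
  "exps c m = {\<alpha>. set \<alpha> \<subseteq> {..c} \<and> length \<alpha> = m}"

lemma finite_exps [simp]: "finite (exps c m)"
  unfolding exps_def by (rule finite_lists_length_eq) simp

lemma card_exps: "card (exps c m) = Suc c ^ m"
  unfolding exps_def by (subst card_lists_length_eq) auto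

lemma exps_mono: "c \<le> c' \<Longrightarrow> exps c m \<subseteq> exps c' m"
  by (auto simp: exps_def)

text \<open>Equality is required only on \<open>T\<close>, so relations valid there, such as a
  normalisation or a trace condition, may be used.\<close>

definition monom_span :: "'t set \<Rightarrow> ('t \<Rightarrow> real) list \<Rightarrow> nat \<Rightarrow> ('t \<Rightarrow> real) set" where
  "monom_span T ys c =
    {h. \<exists>a. \<forall>t\<in>T. h t = (\<Sum>\<alpha>\<in>exps c (length ys). a \<alpha> * fun_monom \<alpha> ys t)}"

lemma monom_span_monom:
  assumes "\<alpha> \<in> exps c (length ys)"
  shows "(\<lambda>t. b * fun_monom \<alpha> ys t) \<in> monom_span T ys c"
proof -
  have "(\<Sum>\<beta>\<in>exps c (length ys). (if \<beta> = \<alpha> then b else 0) * fun_monom \<beta> ys t) = b * fun_monom \<alpha> ys t" for t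
    using assms by (simp add: if_distrib[of "\<lambda>x. x * _"] cong: if_cong)
  then show ?thesis unfolding monom_span_def by (intro CollectI exI[of _ "\<lambda>\<beta>. if \<beta> = \<alpha> then b else 0"]) simp
qed

lemma monom_span_add:
  assumes "f \<in> monom_span T ys c" "g \<in> monom_span T ys c"
  shows "(\<lambda>t. f t + g t) \<in> monom_span T ys c"
proof -
  obtain a b where "\<forall>t\<in>T. f t = (\<Sum>\<alpha>\<in>exps c (length ys). a \<alpha> * fun_monom \<alpha> ys t)"
    "\<forall>t\<in>T. g t = (\<Sum>\<alpha>\<in>exps c (length ys). b \<alpha> * fun_monom \<alpha> ys t)"
    using assms by (auto simp: monom_span_def)
  then show ?thesis unfolding monom_span_def
    by (intro CollectI exI[of _ "\<lambda>\<alpha>. a \<alpha> + b \<alpha>"]) (simp add: sum.distrib algebra_simps)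
qed

lemma monom_span_zero: "(\<lambda>t. 0) \<in> monom_span T ys c"
  unfolding monom_span_def by (intro CollectI exI[of _ "\<lambda>\<alpha>. 0"]) simp

lemma monom_span_sum:
  "(\<And>i. i \<in> A \<Longrightarrow> f i \<in> monom_span T ys c) \<Longrightarrow> (\<lambda>t. \<Sum>i\<in>A. f i t) \<in> monom_span T ys c"
  by (induction A rule: infinite_finite_induct) (auto intro: monom_span_zero monom_span_add)

lemma monom_span_cong:
  "f \<in> monom_span T ys c \<Longrightarrow> (\<And>t. t \<in> T \<Longrightarrow> f t = g t) \<Longrightarrow> g \<in> monom_span T ys c"
  by (auto simp: monom_span_def)

lemma monom_span_mono:
  assumes "f \<in> monom_span T ys c" "c \<le> c'"
  shows "f \<in> monom_span T ys c'"
proof -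
  obtain a where a: "\<forall>t\<in>T. f t = (\<Sum>\<alpha>\<in>exps c (length ys). a \<alpha> * fun_monom \<alpha> ys t)"
    using assms by (auto simp: monom_span_def)
  have "(\<lambda>t. \<Sum>\<alpha>\<in>exps c (length ys). a \<alpha> * fun_monom \<alpha> ys t) \<in> monom_span T ys c'"
    using exps_mono[OF assms(2)] by (intro monom_span_sum monom_span_monom) auto
  then show ?thesis by (rule monom_span_cong) (use a in auto)
qed

lemma fun_monom_mult:
  "length \<alpha> = length ys \<Longrightarrow> length \<beta> = length ys \<Longrightarrow>
    fun_monom \<alpha> ys t * fun_monom \<beta> ys t = fun_monom (map2 (+) \<alpha> \<beta>) ys t"
proof (induction ys arbitrary: \<alpha> \<beta>)
  case (Cons y ys)
  then obtain a \<alpha>' b \<beta>' where "\<alpha> = a # \<alpha>'" "\<beta> = b # \<beta>'" by (metis length_Suc_conv)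
  with Cons Cons.IH[of \<alpha>' \<beta>'] show ?case by (simp add: power_add)
qed auto

lemma map2_add_exps:
  assumes "\<alpha> \<in> exps c m" "\<beta> \<in> exps c' m"
  shows "map2 (+) \<alpha> \<beta> \<in> exps (c + c') m"
  using assms by (fastforce simp: exps_def dest: set_zip_leftD set_zip_rightD intro!: add_mono)

lemma monom_span_mult:
  assumes "f \<in> monom_span T ys c" "g \<in> monom_span T ys c'"
  shows "(\<lambda>t. f t * g t) \<in> monom_span T ys (c + c')"
proof -
  obtain a b where ab: "\<forall>t\<in>T. f t = (\<Sum>\<alpha>\<in>exps c (length ys). a \<alpha> * fun_monom \<alpha> ys t)"
    "\<forall>t\<in>T. g t = (\<Sum>\<alpha>\<in>exps c' (length ys). b \<alpha> * fun_monom \<alpha> ys t)"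
    using assms by (auto simp: monom_span_def)
  have "(\<lambda>t. \<Sum>\<alpha>\<in>exps c (length ys). \<Sum>\<beta>\<in>exps c' (length ys).
      (a \<alpha> * b \<beta>) * fun_monom (map2 (+) \<alpha> \<beta>) ys t) \<in> monom_span T ys (c + c')"
    by (intro monom_span_sum monom_span_monom map2_add_exps)
  then show ?thesis
  proof (rule monom_span_cong)
    fix t assume t: "t \<in> T"
    have "a \<alpha> * b \<beta> * fun_monom (map2 (+) \<alpha> \<beta>) ys t = (a \<alpha> * fun_monom \<alpha> ys t) * (b \<beta> * fun_monom \<beta> ys t)"
      if "\<alpha> \<in> exps c (length ys)" "\<beta> \<in> exps c' (length ys)" for \<alpha> \<beta>
    proof -
      have "fun_monom \<alpha> ys t * fun_monom \<beta> ys t = fun_monom (map2 (+) \<alpha> \<beta>) ys t"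
        using that by (intro fun_monom_mult) (auto simp: exps_def)
      then show ?thesis by (metis mult.assoc mult.left_commute)
    qed
    then have "(\<Sum>\<alpha>\<in>exps c (length ys). \<Sum>\<beta>\<in>exps c' (length ys).
        (a \<alpha> * b \<beta>) * fun_monom (map2 (+) \<alpha> \<beta>) ys t) =
      (\<Sum>\<alpha>\<in>exps c (length ys). \<Sum>\<beta>\<in>exps c' (length ys).
        (a \<alpha> * fun_monom \<alpha> ys t) * (b \<beta> * fun_monom \<beta> ys t))"
      by (intro sum.cong refl)
    with t ab show "(\<Sum>\<alpha>\<in>exps c (length ys). \<Sum>\<beta>\<in>exps c' (length ys).
      (a \<alpha> * b \<beta>) * fun_monom (map2 (+) \<alpha> \<beta>) ys t) = f t * g t"
      by (simp add: sum_product)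
  qed
qed

lemma fun_monom_replicate_0: "fun_monom (replicate n 0) ys t = 1"
  by (induction ys arbitrary: n; case_tac n) auto

lemma monom_span_const: "(\<lambda>t. b) \<in> monom_span T ys c"
proof -
  have "replicate (length ys) 0 \<in> exps c (length ys)" by (auto simp: exps_def)
  from monom_span_monom[OF this, of b T] show ?thesis by (simp add: fun_monom_replicate_0)
qed

lemma fun_monom_unit: "i < length ys \<Longrightarrow> fun_monom ((replicate (length ys) 0)[i := 1]) ys t = (ys ! i) t"
proof (induction ys arbitrary: i)
  case (Cons y ys)
  then show ?case by (cases i) (auto simp: fun_monom_replicate_0)
qed auto

lemma monom_span_coord:
  assumes "y \<in> set ys" shows "y \<in> monom_span T ys 1"
proof -
  obtain i where i: "i < length ys" "ys ! i = y" using assms by (auto simp: in_set_conv_nth)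
  have "(replicate (length ys) 0)[i := 1] \<in> exps 1 (length ys)"
    using set_update_subset_insert[of "replicate (length ys) 0" i "1::nat"] by (fastforce simp: exps_def)
  from monom_span_monom[OF this, of 1 T]
  have "(\<lambda>t. 1 * fun_monom ((replicate (length ys) 0)[i := 1]) ys t) \<in> monom_span T ys 1" .
  then show ?thesis unfolding fun_monom_unit[OF i(1)] i(2) by simp
qed

lemma monom_span_power:
  "f \<in> monom_span T ys c \<Longrightarrow> (\<lambda>t. f t ^ n) \<in> monom_span T ys (c * n)"
proof (induction n)
  case 0 show ?case by (simp add: monom_span_const)
next
  case (Suc n)
  then show ?case using monom_span_mult[of f T ys c "\<lambda>t. f t ^ n" "c * n"] by simp
qed

definition poly_in :: "'t set \<Rightarrow> ('t \<Rightarrow> real) list \<Rightarrow> ('t \<Rightarrow> real) \<Rightarrow> bool" where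
  "poly_in T ys f \<longleftrightarrow> (\<exists>c. f \<in> monom_span T ys c)"

lemma poly_in_const: "poly_in T ys (\<lambda>t. b)"
  unfolding poly_in_def using monom_span_const by (rule exI[of _ 0])

lemma poly_in_coord: "y \<in> set ys \<Longrightarrow> poly_in T ys y"
  unfolding poly_in_def using monom_span_coord by (rule exI[of _ 1])

lemma poly_in_add: "poly_in T ys f \<Longrightarrow> poly_in T ys g \<Longrightarrow> poly_in T ys (\<lambda>t. f t + g t)"
proof -
  assume "poly_in T ys f" "poly_in T ys g"
  then obtain c c' where "f \<in> monom_span T ys c" "g \<in> monom_span T ys c'"
    by (auto simp: poly_in_def)
  then have "(\<lambda>t. f t + g t) \<in> monom_span T ys (max c c')"
    by (intro monom_span_add) (auto elim: monom_span_mono)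
  then show ?thesis unfolding poly_in_def by (rule exI)
qed

lemma poly_in_mult: "poly_in T ys f \<Longrightarrow> poly_in T ys g \<Longrightarrow> poly_in T ys (\<lambda>t. f t * g t)"
  unfolding poly_in_def by (elim exE, rule exI, rule monom_span_mult)

lemma poly_in_minus: "poly_in T ys f \<Longrightarrow> poly_in T ys (\<lambda>t. - f t)"
  using poly_in_mult[OF poly_in_const[of T ys "-1"]] by simp

lemma poly_in_diff: "poly_in T ys f \<Longrightarrow> poly_in T ys g \<Longrightarrow> poly_in T ys (\<lambda>t. f t - g t)"
  using poly_in_add[OF _ poly_in_minus, of T ys f g] by simp

lemma poly_in_power: "poly_in T ys f \<Longrightarrow> poly_in T ys (\<lambda>t. f t ^ n)"
  unfolding poly_in_def by (elim exE, rule exI, rule monom_span_power)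

lemma poly_in_sum:
  "(\<And>i. i \<in> A \<Longrightarrow> poly_in T ys (f i)) \<Longrightarrow> poly_in T ys (\<lambda>t. \<Sum>i\<in>A. f i t)"
  by (induction A rule: infinite_finite_induct) (auto intro: poly_in_const poly_in_add)

lemma poly_in_cong:
  "poly_in T ys f \<Longrightarrow> (\<And>t. t \<in> T \<Longrightarrow> f t = g t) \<Longrightarrow> poly_in T ys g"
  unfolding poly_in_def using monom_span_cong by blast

lemmas poly_in_intros = poly_in_const poly_in_add poly_in_mult poly_in_minus
  poly_in_diff poly_in_power poly_in_sum

section \<open>Composition with a rational parametrisation\<close>

text \<open>Here \<open>n\<close> is a common denominator of the real coordinates of
  \<open>\<psi>\<close>. For sums and products of polynomials the powers of \<open>n\<close> that
  clear the two operands are added.\<close>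

lemma poly_in_compose:
  assumes n: "poly_in T ys n"
    and lin: "\<And>f. bounded_linear f \<Longrightarrow> poly_in T ys (\<lambda>t. n t * f (\<psi> t))"
    and f: "real_polynomial_function f"
  shows "\<exists>e. poly_in T ys (\<lambda>t. n t ^ e * f (\<psi> t))"
  using f
proof induction
  case (linear f)
  then show ?case using lin by (intro exI[of _ 1]) simp
next
  case (const c)
  then show ?case by (intro exI[of _ 0]) (simp add: poly_in_const)
next
  case (add f g)
  then obtain d e where "poly_in T ys (\<lambda>t. n t ^ d * f (\<psi> t))" "poly_in T ys (\<lambda>t. n t ^ e * g (\<psi> t))" by auto
  then have "poly_in T ys (\<lambda>t. n t ^ e * (n t ^ d * f (\<psi> t)) + n t ^ d * (n t ^ e * g (\<psi> t)))"
    by (rule poly_in_add[OF poly_in_mult[OF poly_in_power[OF n]] poly_in_mult[OF poly_in_power[OF n]]])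
  then show ?case by (intro exI[of _ "d + e"]) (simp add: algebra_simps power_add)
next
  case (mult f g)
  then obtain d e where "poly_in T ys (\<lambda>t. n t ^ d * f (\<psi> t))" "poly_in T ys (\<lambda>t. n t ^ e * g (\<psi> t))" by auto
  then have "poly_in T ys (\<lambda>t. (n t ^ d * f (\<psi> t)) * (n t ^ e * g (\<psi> t)))"
    by (rule poly_in_mult)
  then show ?case by (intro exI[of _ "d + e"]) (simp add: algebra_simps power_add)
qed

text \<open>The counting argument needs one power of the denominator and one exponent bound for all
  the given polynomials at once. Spare powers of \<open>n\<close> lie in a span themselves and are
  multiplied in.\<close>

lemma poly_in_compose_uniform:
  assumes n: "poly_in T ys n"
    and lin: "\<And>f. bounded_linear f \<Longrightarrow> poly_in T ys (\<lambda>t. n t * f (\<psi> t))"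
    and "\<And>x. x \<in> set xs \<Longrightarrow> real_polynomial_function x"
  shows "\<exists>e c. (\<lambda>t. n t ^ e) \<in> monom_span T ys c \<and>
    (\<forall>x\<in>set xs. (\<lambda>t. n t ^ e * x (\<psi> t)) \<in> monom_span T ys c)"
  using assms(3)
proof (induction xs)
  case Nil
  show ?case by (intro exI[of _ 0]) (simp add: monom_span_const)
next
  case (Cons x xs)
  then obtain e c where ec: "(\<lambda>t. n t ^ e) \<in> monom_span T ys c"
    "\<forall>x\<in>set xs. (\<lambda>t. n t ^ e * x (\<psi> t)) \<in> monom_span T ys c" by auto
  obtain e' where "poly_in T ys (\<lambda>t. n t ^ e' * x (\<psi> t))"
    using poly_in_compose[where \<psi> = \<psi>, OF n lin, of x] Cons.prems by auto
  then obtain c' where c': "(\<lambda>t. n t ^ e' * x (\<psi> t)) \<in> monom_span T ys c'" by (auto simp: poly_in_def)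
  obtain c'' where c'': "(\<lambda>t. n t ^ e') \<in> monom_span T ys c''"
    using poly_in_power[OF n] by (auto simp: poly_in_def)
  let ?c = "c + c' + c''"
  have "(\<lambda>t. n t ^ (e + e')) \<in> monom_span T ys ?c"
    using monom_span_mono[OF monom_span_mult[OF ec(1) c''], of ?c] by (simp add: power_add)
  moreover have "(\<lambda>t. n t ^ (e + e') * x (\<psi> t)) \<in> monom_span T ys ?c"
    using monom_span_mono[OF monom_span_mult[OF ec(1) c'], of ?c] by (simp add: power_add mult_ac)
  moreover have "(\<lambda>t. n t ^ (e + e') * y (\<psi> t)) \<in> monom_span T ys ?c" if "y \<in> set xs" for y
    using monom_span_mono[OF monom_span_mult[OF bspec[OF ec(2) that] c''], of ?c] by (simp add: power_add mult_ac)
  ultimately show ?case by (intro exI[of _ "e + e'"] exI[of _ ?c]) auto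
qed

text \<open>Each function in \<open>xs\<close> receives \<open>D\<close> factors \<open>m\<close>:
  if its exponent is \<open>a\<close>, then \<open>a\<close> of them clear denominators and the
  other \<open>D - a\<close> are kept as polynomials. Thus neither the power of \<open>m\<close> nor
  the exponent bound depends on \<open>\<alpha>\<close>.\<close>

lemma fun_monom_compose_span:
  assumes n: "m \<in> monom_span T ys c"
    and x: "\<And>x. x \<in> set xs \<Longrightarrow> (\<lambda>t. m t * x (\<psi> t)) \<in> monom_span T ys c"
    and "\<alpha> \<in> exps D (length xs)"
  shows "(\<lambda>t. m t ^ (D * length xs) * fun_monom \<alpha> xs (\<psi> t)) \<in> monom_span T ys (c * D * length xs)"
  using assms(2,3)
proof (induction xs arbitrary: \<alpha>)
  case Nil
  then show ?case by (simp add: monom_span_const)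
next
  case (Cons x xs)
  then obtain a \<alpha>' where a: "\<alpha> = a # \<alpha>'" "a \<le> D" "\<alpha>' \<in> exps D (length xs)"
    by (cases \<alpha>) (auto simp: exps_def)
  have "(\<lambda>t. (m t * x (\<psi> t)) ^ a) \<in> monom_span T ys (c * a)"
    using Cons.prems by (intro monom_span_power) auto
  from monom_span_mult[OF this monom_span_power[OF n, of "D - a"]]
  have 1: "(\<lambda>t. (m t * x (\<psi> t)) ^ a * m t ^ (D - a)) \<in> monom_span T ys (c * D)"
    using a(2) by (simp flip: distrib_left)
  have "(\<lambda>t. m t ^ (D * length xs) * fun_monom \<alpha>' xs (\<psi> t)) \<in> monom_span T ys (c * D * length xs)"
    using Cons.prems a by (intro Cons.IH) auto
  from monom_span_mult[OF 1 this]
  have "(\<lambda>t. (m t * x (\<psi> t)) ^ a * m t ^ (D - a) * (m t ^ (D * length xs) * fun_monom \<alpha>' xs (\<psi> t)))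
    \<in> monom_span T ys (c * D * length (x # xs))" by (simp add: algebra_simps)
  moreover have "(m t * x (\<psi> t)) ^ a * m t ^ (D - a) * (m t ^ (D * length xs) * fun_monom \<alpha>' xs (\<psi> t)) =
    m t ^ (D * length (x # xs)) * fun_monom \<alpha> (x # xs) (\<psi> t)" for t
  proof -
    have "m t ^ D = m t ^ a * m t ^ (D - a)" using a(2) by (simp flip: power_add)
    then show ?thesis by (simp add: a power_mult_distrib power_add)
  qed
  ultimately show ?case by simp
qed

text \<open>Monomials of bounded exponents in \<open>k > length ys\<close> polynomials outnumber the monomials in \<open>ys\<close>
  that occur in them, so any such polynomials are algebraically dependent on \<open>\<psi> ` T\<close>.\<close>

lemma prime_chain_length_le:
  fixes \<psi> :: "'t \<Rightarrow> 'a::euclidean_space"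
  assumes n0: "\<And>t. t \<in> T \<Longrightarrow> n t \<noteq> 0"
    and n: "poly_in T ys n"
    and lin: "\<And>f. bounded_linear f \<Longrightarrow> poly_in T ys (\<lambda>t. n t * f (\<psi> t))"
    and prime: "\<And>i. i \<le> k \<Longrightarrow> primeideal (P i) poly_fun_ring"
    and strict: "\<And>i. i < k \<Longrightarrow> P i \<subset> P (Suc i)"
    and vanish: "vanishing_ideal (\<psi> ` T) \<subseteq> P 0"
  shows "k \<le> length ys"
proof (rule ccontr)
  assume "\<not> k \<le> length ys"
  then have k: "length ys < k" by simp
  \<comment> \<open>Witnesses of the strict inclusions; by \<open>prime_chain_monom\<close> no
    nontrivial polynomial expression in them lies in \<open>P 0\<close>.\<close>
  have "\<exists>x. \<forall>i. i < k \<longrightarrow> x i \<in> P (Suc i) - P i"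
    by (rule choice) (use strict in blast)
  then obtain x where x: "\<And>i. i < k \<Longrightarrow> x i \<in> P (Suc i) - P i" by auto
  define xs where "xs = map x [0..<k]"
  have len: "length xs = k" by (simp add: xs_def)
  have pxs: "real_polynomial_function f" if "f \<in> set xs" for f
  proof -
    obtain i where "i < k" "f = x i" using \<open>f \<in> set xs\<close> by (auto simp: xs_def)
    with x[of i] prime[of "Suc i"] show ?thesis by (auto intro: prime_poly)
  qed
  obtain e c where ec: "(\<lambda>t. n t ^ e) \<in> monom_span T ys c"
    "\<forall>x\<in>set xs. (\<lambda>t. n t ^ e * x (\<psi> t)) \<in> monom_span T ys c"
    using poly_in_compose_uniform[where \<psi> = \<psi> and xs = xs, OF n lin pxs] by auto
  define C where "C = c * k + 1"
  \<comment> \<open>With \<open>m = length ys\<close>: \<open>Suc E \<le> C * Suc D\<close> and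
    \<open>C ^ m = D\<close>, so the \<open>Suc E ^ m\<close> target monomials number at most
    \<open>D * Suc D ^ m\<close>. This is less than \<open>Suc D ^ (m + 1)\<close>, and hence than
    the number \<open>Suc D ^ k\<close> of source monomials.\<close>
  define D where "D = C ^ length ys"
  define E where "E = c * D * k"
  have "\<exists>A. \<forall>\<alpha>. \<alpha> \<in> exps D k \<longrightarrow> (\<forall>t\<in>T. (n t ^ e) ^ (D * k) * fun_monom \<alpha> xs (\<psi> t) =
     (\<Sum>\<beta>\<in>exps E (length ys). A \<alpha> \<beta> * fun_monom \<beta> ys t))"
    using fun_monom_compose_span[OF ec(1), of xs \<psi> _ D] ec(2)
    by (intro choice) (auto simp: monom_span_def len E_def)
  then obtain A where A: "\<And>\<alpha> t. \<alpha> \<in> exps D k \<Longrightarrow> t \<in> T \<Longrightarrow> (n t ^ e) ^ (D * k) * fun_monom \<alpha> xs (\<psi> t) =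
     (\<Sum>\<beta>\<in>exps E (length ys). A \<alpha> \<beta> * fun_monom \<beta> ys t)" by blast
  have "Suc E \<le> C * Suc D" by (simp add: E_def C_def algebra_simps)
  then have "card (exps E (length ys)) \<le> (C * Suc D) ^ length ys"
    unfolding card_exps by (rule power_mono) simp
  also have "\<dots> = D * Suc D ^ length ys" by (simp only: D_def power_mult_distrib)
  also have "\<dots> < Suc D ^ Suc (length ys)" by simp
  also have "\<dots> \<le> Suc D ^ k" using k by (intro power_increasing) auto
  also have "\<dots> = card (exps D k)" by (simp add: card_exps)
  finally obtain a where a: "\<exists>\<alpha>\<in>exps D k. a \<alpha> \<noteq> 0"
    "\<forall>\<beta>\<in>exps E (length ys). (\<Sum>\<alpha>\<in>exps D k. a \<alpha> * A \<alpha> \<beta>) = 0"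
    using homogeneous_system_nontrivial[of "exps E (length ys)" "exps D k" A] by auto
  let ?F = "\<lambda>v. \<Sum>\<alpha>\<in>exps D k. a \<alpha> * fun_monom \<alpha> xs v"
  \<comment> \<open>The relation is first shown after multiplication by a power of \<open>n\<close>,
    which is nonzero on \<open>T\<close> and cancels.\<close>
  have "?F (\<psi> t) = 0" if t: "t \<in> T" for t
  proof -
    have "(n t ^ e) ^ (D * k) * ?F (\<psi> t) =
      (\<Sum>\<alpha>\<in>exps D k. a \<alpha> * ((n t ^ e) ^ (D * k) * fun_monom \<alpha> xs (\<psi> t)))"
      by (simp add: sum_distrib_left mult_ac)
    also have "\<dots> = (\<Sum>\<alpha>\<in>exps D k. a \<alpha> * (\<Sum>\<beta>\<in>exps E (length ys). A \<alpha> \<beta> * fun_monom \<beta> ys t))"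
      using A t by (intro sum.cong) auto
    also have "\<dots> = (\<Sum>\<beta>\<in>exps E (length ys). (\<Sum>\<alpha>\<in>exps D k. a \<alpha> * A \<alpha> \<beta>) * fun_monom \<beta> ys t)"
      unfolding sum_distrib_left sum_distrib_right by (subst sum.swap) (simp add: mult_ac)
    also have "\<dots> = 0" using a by simp
    finally show ?thesis using n0[OF t] by simp
  qed
  moreover have "real_polynomial_function ?F"
    by (intro real_polynomial_function_sum real_polynomial_function.intros(4) real_polynomial_function.intros(2)
        real_polynomial_function_fun_monom pxs finite_exps)
  ultimately have "?F \<in> vanishing_ideal (\<psi> ` T)" by (auto simp: vanishing_ideal_def)
  moreover obtain \<alpha> where \<alpha>: "\<alpha> \<in> exps D k" "a \<alpha> \<noteq> 0" using a(1) by auto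
  have "?F \<notin> P 0"
  proof (rule prime_chain_monom[where c = a, OF _ _ _ _ _ \<alpha>])
    show "xs ! i \<in> P (Suc i) - P i" if "i < length xs" for i using x that by (simp add: xs_def)
    show "length \<beta> = length xs" if "\<beta> \<in> exps D k" for \<beta> using that by (simp add: len exps_def)
  qed (use prime strict len in auto)
  ultimately show False using vanish by auto
qed

text \<open>If for each \<open>c\<close> some function outside \<open>P\<close> vanished on
  \<open>V c\<close>, the product of these functions would vanish on the union but, by primality,
  lie outside \<open>P\<close>. For the empty union the product is the constant 1.\<close>

lemma vanishing_ideal_UN_prime:
  assumes P: "primeideal P poly_fun_ring" and C: "finite C"
    and "vanishing_ideal (\<Union>c\<in>C. V c) \<subseteq> P"
  shows "\<exists>c\<in>C. vanishing_ideal (V c) \<subseteq> P"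
proof (rule ccontr)
  assume *: "\<not> ?thesis"
  from C have "\<exists>g. g \<in> vanishing_ideal (\<Union>c\<in>C. V c) \<and> g \<notin> P" using *
  proof (induction C rule: finite_induct)
    case empty
    show ?case using prime_const[OF P, of 1]
      by (intro exI[of _ "\<lambda>x. 1"]) (auto simp: vanishing_ideal_def)
  next
    case (insert c C)
    then obtain f g where "f \<in> vanishing_ideal (V c)" "f \<notin> P" "g \<in> vanishing_ideal (\<Union>c\<in>C. V c)" "g \<notin> P"
      by auto
    then show ?case using prime_mult[OF P, of f g]
      by (intro exI[of _ "\<lambda>x. f x * g x"]) (auto simp: vanishing_ideal_def)
  qed
  with assms(3) show False by auto
qed


section \<open>Affine subspaces and the space of Hermitian matrices of trace one\<close>

text \<open>Reduces polynomial functions on affine sets to real polynomials in one variable, of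
  which the nonzero ones have finitely many zeros.\<close>

lemma real_polynomial_function_line:
  fixes f :: "'a::euclidean_space \<Rightarrow> real"
  assumes "real_polynomial_function f"
  shows "real_polynomial_function (\<lambda>t::real. f (x + t *\<^sub>R v))"
proof -
  have "polynomial_function (\<lambda>t::real. x + t *\<^sub>R v)"
    by (intro polynomial_function_add polynomial_function_const polynomial_function_mult) auto
  from real_polynomial_function_compose[OF this assms] show ?thesis by (simp add: o_def)
qed

lemma real_polynomial_function_finite_zeros:
  fixes p :: "real \<Rightarrow> real"
  assumes "real_polynomial_function p" "p s \<noteq> 0"
  shows "finite {t. p t = 0}"
proof -
  obtain a n where p: "p = (\<lambda>x. \<Sum>i\<le>n. a i * x ^ i)"
    using assms(1) real_polynomial_function_iff_sum by blast
  with assms(2) have "\<exists>i\<le>n. a i \<noteq> 0" by (metis (no_types, lifting) atMost_iff mult_zero_left sum.neutral)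
  then show ?thesis unfolding p by (subst polyfun_finite_roots) auto
qed

lemma affine_line_mem:
  "affine A \<Longrightarrow> x \<in> A \<Longrightarrow> y \<in> A \<Longrightarrow> x + t *\<^sub>R (y - x) \<in> A"
  unfolding affine_alt by (simp add: algebra_simps)

text \<open>If \<open>f\<close> is nonzero at \<open>x\<close> and \<open>g\<close> at
  \<open>y\<close>, then along the line from \<open>x\<close> to \<open>y\<close> each vanishes for
  finitely many parameters only. The line lies in \<open>A\<close>, so \<open>f * g\<close> cannot
  vanish on all of \<open>A\<close>.\<close>

lemma vanishing_ideal_affine_prime:
  fixes A :: "'a::euclidean_space set"
  assumes A: "affine A" "A \<noteq> {}"
  shows "primeideal (vanishing_ideal A) poly_fun_ring"
proof (rule primeidealI[OF vanishing_ideal_ideal poly_fun_ring_cring])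
  have "(\<lambda>x. 1) \<in> carrier (poly_fun_ring :: ('a \<Rightarrow> real) ring)" "(\<lambda>x. 1) \<notin> vanishing_ideal A"
    using A by (auto simp: vanishing_ideal_def)
  then show "carrier poly_fun_ring \<noteq> vanishing_ideal A" by metis
  fix f g :: "'a \<Rightarrow> real"
  assume "f \<in> carrier poly_fun_ring" "g \<in> carrier poly_fun_ring"
    and fg: "f \<otimes>\<^bsub>poly_fun_ring\<^esub> g \<in> vanishing_ideal A"
  then have pf: "real_polynomial_function f" and pg: "real_polynomial_function g"
    and fg: "\<And>x. x \<in> A \<Longrightarrow> f x * g x = 0"
    by (auto simp: vanishing_ideal_def poly_fun_ring_def)
  have "g y = 0" if x: "x \<in> A" "f x \<noteq> 0" and y: "y \<in> A" for x y
  proof (rule ccontr)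
    assume "g y \<noteq> 0"
    then have "finite {t. g (x + t *\<^sub>R (y - x)) = 0}"
      by (intro real_polynomial_function_finite_zeros[of _ 1] real_polynomial_function_line pg) simp
    moreover have "finite {t. f (x + t *\<^sub>R (y - x)) = 0}"
      using x by (intro real_polynomial_function_finite_zeros[of _ 0] real_polynomial_function_line pf) simp
    ultimately have "finite ({t. g (x + t *\<^sub>R (y - x)) = 0} \<union> {t. f (x + t *\<^sub>R (y - x)) = 0})" by simp
    moreover have "{t. g (x + t *\<^sub>R (y - x)) = 0} \<union> {t. f (x + t *\<^sub>R (y - x)) = 0} = UNIV"
      using fg affine_line_mem[OF A(1) x(1) y] by auto
    ultimately show False using infinite_UNIV_char_0[where 'a = real] by simp
  qed
  then show "f \<in> vanishing_ideal A \<or> g \<in> vanishing_ideal A"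
    using pf pg by (auto simp: vanishing_ideal_def)
qed

text \<open>A polynomial vanishing on \<open>S\<close> vanishes on a short piece of every line in
  \<open>A\<close> through \<open>x\<close>, hence for infinitely many parameters, and so on the
  whole line.\<close>

lemma vanishing_ideal_rel_open:
  fixes A :: "'a::euclidean_space set"
  assumes "affine A" "S \<subseteq> A" "x \<in> A" "0 < e" and near: "\<And>y. y \<in> A \<Longrightarrow> dist x y < e \<Longrightarrow> y \<in> S"
  shows "vanishing_ideal S = vanishing_ideal A"
proof
  show "vanishing_ideal A \<subseteq> vanishing_ideal S" using assms(2) by (auto simp: vanishing_ideal_def)
  show "vanishing_ideal S \<subseteq> vanishing_ideal A"
  proof
    fix f assume f: "f \<in> vanishing_ideal S"
    then have pf: "real_polynomial_function f" by (simp add: vanishing_ideal_def)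
    have "f y = 0" if y: "y \<in> A" for y
    proof (rule ccontr)
      assume "f y \<noteq> 0"
      then have "finite {t. f (x + t *\<^sub>R (y - x)) = 0}"
        by (intro real_polynomial_function_finite_zeros[of _ 1] real_polynomial_function_line pf) simp
      \<comment> \<open>The summand 1 keeps the denominator positive when
        \<open>y = x\<close>.\<close>
      moreover define d where "d = e / (norm (y - x) + 1)"
      have d: "0 < d" using assms(4) by (simp add: d_def add_nonneg_pos)
      have "{0<..<d} \<subseteq> {t. f (x + t *\<^sub>R (y - x)) = 0}"
      proof
        fix t assume t: "t \<in> {0<..<d}"
        then have "t * norm (y - x) \<le> t * (norm (y - x) + 1)" by simp
        also have "\<dots> < d * (norm (y - x) + 1)" using t by (intro mult_strict_right_mono) (auto intro: add_nonneg_pos)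
        also have "\<dots> = e" by (simp add: d_def add_nonneg_eq_0_iff)
        finally have "dist x (x + t *\<^sub>R (y - x)) < e" using t by (simp add: dist_norm)
        with near affine_line_mem[OF assms(1,3) y] have "x + t *\<^sub>R (y - x) \<in> S" by blast
        with f show "t \<in> {t. f (x + t *\<^sub>R (y - x)) = 0}" by (simp add: vanishing_ideal_def)
      qed
      ultimately have "finite {0<..<d}" by (rule finite_subset[rotated])
      then show False using infinite_Ioo[OF d] by simp
    qed
    with pf show "f \<in> vanishing_ideal A" by (simp add: vanishing_ideal_def)
  qed
qed

text \<open>Imposing one more equation \<open>l j = 0\<close> at a time gives a flag of affine
  subspaces. The point \<open>w i\<close> lies in the \<open>i\<close>-th one and \<open>l i\<close>
  does not vanish there, so the vanishing ideals grow strictly.\<close>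

lemma affine_prime_chain:
  fixes A :: "'a::euclidean_space set" and l :: "nat \<Rightarrow> 'a \<Rightarrow> real"
  assumes A: "affine A"
    and l: "\<And>i. i < m \<Longrightarrow> bounded_linear (l i)"
    and w: "\<And>i. i \<le> m \<Longrightarrow> w i \<in> A"
    and l0: "\<And>i j. i \<le> m \<Longrightarrow> j < i \<Longrightarrow> l j (w i) = 0"
    and l1: "\<And>i. i < m \<Longrightarrow> l i (w i) \<noteq> 0"
  shows "\<exists>P. (\<forall>i\<le>m. primeideal (P i) poly_fun_ring \<and> vanishing_ideal A \<subseteq> P i) \<and>
    (\<forall>i<m. P i \<subset> P (Suc i))"
proof -
  define B where "B i = {x\<in>A. \<forall>j<i. l j x = 0}" for i
  have "affine (B i)" if "i \<le> m" for i
  proof -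
    have "l j (u *\<^sub>R x + v *\<^sub>R y) = u * l j x + v * l j y" if "j < i" for j u v x y
    proof -
      interpret bounded_linear "l j" by (rule l) (use \<open>j < i\<close> \<open>i \<le> m\<close> in linarith)
      show ?thesis by (simp add: add scaleR)
    qed
    then show ?thesis using A unfolding affine_def B_def by simp
  qed
  moreover have wB: "w i \<in> B i" if "i \<le> m" for i using w l0 that by (auto simp: B_def)
  ultimately have "primeideal (vanishing_ideal (B i)) poly_fun_ring" if "i \<le> m" for i
    using that by (intro vanishing_ideal_affine_prime) auto
  moreover have "vanishing_ideal A \<subseteq> vanishing_ideal (B i)" for i by (auto simp: vanishing_ideal_def B_def)
  moreover have "vanishing_ideal (B i) \<subset> vanishing_ideal (B (Suc i))" if i: "i < m" for i
  proof -
    have "vanishing_ideal (B i) \<subseteq> vanishing_ideal (B (Suc i))" by (auto simp: vanishing_ideal_def B_def)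
    moreover have "l i \<in> vanishing_ideal (B (Suc i))"
      using l[OF i] by (auto simp: vanishing_ideal_def B_def intro: real_polynomial_function.intros(1))
    moreover have "l i \<notin> vanishing_ideal (B i)"
      using wB[of i] l1[OF i] i by (auto simp: vanishing_ideal_def)
    ultimately show ?thesis by blast
  qed
  ultimately show ?thesis by (intro exI[of _ "\<lambda>i. vanishing_ideal (B i)"]) auto
qed

text \<open>As \<open>f\<close> is only real linear, the basis contains the multiples by
  \<open>\<i>\<close> of the matrix units too. To see that all functionals are polynomial in some
  coordinates, it then suffices to treat real and imaginary parts of entries.\<close>

lemma bounded_linear_matrix_expand:
  fixes f :: "complex ^ 'n::finite ^ 'm::finite \<Rightarrow> real"
  assumes "bounded_linear f"
  shows "f A = (\<Sum>p\<in>UNIV. \<Sum>q\<in>UNIV. Re (A $ p $ q) * f (axis p (axis q 1)) + Im (A $ p $ q) * f (axis p (axis q \<i>)))"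
proof -
  interpret bounded_linear f by fact
  have "A = (\<Sum>p\<in>UNIV. \<Sum>q\<in>UNIV. Re (A $ p $ q) *\<^sub>R axis p (axis q 1) + Im (A $ p $ q) *\<^sub>R axis p (axis q \<i>))"
    (is "A = ?B")
  proof -
    have "?B $ i $ j = A $ i $ j" for i j
    proof -
      have "?B $ i $ j = (\<Sum>p\<in>UNIV. \<Sum>q\<in>UNIV. if p = i then if q = j then A $ p $ q else 0 else 0)"
        unfolding sum_component
        by (intro sum.cong refl) (auto simp: axis_def complex_eq_iff)
      also have "\<dots> = (\<Sum>p\<in>UNIV. if p = i then (\<Sum>q\<in>UNIV. if q = j then A $ p $ q else 0) else 0)"
        by (intro sum.cong refl) auto
      also have "\<dots> = A $ i $ j" by simp
      finally show ?thesis .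
    qed
    then show ?thesis by (simp add: vec_eq_iff)
  qed
  then have "f A = f ?B" by (rule arg_cong)
  then show ?thesis by (simp add: sum add scaleR)
qed

section \<open>Coordinates on the Hermitian matrices of trace 1\<close>

lemma hermitianD: "hermitian A \<Longrightarrow> cnj (A $ p $ q) = A $ q $ p"
  unfolding hermitian_def by metis

definition herm_plane :: "(complex ^ 'c ^ 'c::finite) set" where
  "herm_plane = {A. hermitian A \<and> trace A = 1}"

lemma affine_herm_plane: "affine herm_plane"
  unfolding affine_def
proof (intro ballI allI impI)
  fix A B :: "complex ^ 'c ^ 'c" and u v :: real
  assume AB: "A \<in> herm_plane" "B \<in> herm_plane" "u + v = 1"
  have "hermitian (u *\<^sub>R A + v *\<^sub>R B)"
    unfolding hermitian_def
  proof (intro allI)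
    fix p q
    have "cnj (A $ q $ p) = A $ p $ q" "cnj (B $ q $ p) = B $ p $ q"
      using AB by (auto simp: herm_plane_def intro: hermitianD)
    then show "(u *\<^sub>R A + v *\<^sub>R B) $ p $ q = cnj ((u *\<^sub>R A + v *\<^sub>R B) $ q $ p)" by simp
  qed
  moreover have "trace (u *\<^sub>R A + v *\<^sub>R B) = u *\<^sub>R trace A + v *\<^sub>R trace B"
    unfolding trace_def by (simp add: sum.distrib scaleR_right.sum)
  with AB have "trace (u *\<^sub>R A + v *\<^sub>R B) = 1"
    by (simp add: herm_plane_def flip: scaleR_left_distrib)
  ultimately show "u *\<^sub>R A + v *\<^sub>R B \<in> herm_plane" by (simp add: herm_plane_def)
qed

text \<open>On Hermitian matrices the real and imaginary parts are the symmetric and the antisymmetric part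
  of the real matrix of these functionals, which are therefore real coordinates.\<close>

definition herm_coord :: "'c \<times> 'c \<Rightarrow> complex ^ 'c ^ 'c \<Rightarrow> real" where
  "herm_coord r A = Re (A $ fst r $ snd r) + Im (A $ fst r $ snd r)"

lemma bounded_linear_herm_coord: "bounded_linear (herm_coord r :: complex ^ 'c ^ 'c::finite \<Rightarrow> real)"
  unfolding linear_conv_bounded_linear[symmetric]
  by (rule linearI) (simp_all add: herm_coord_def algebra_simps)

lemma herm_coord_add: "herm_coord r (A + B) = herm_coord r A + herm_coord r B"
  by (simp add: herm_coord_def)

lemma herm_coord_axis:
  "herm_coord r (axis p (axis q z)) = (if r = (p, q) then Re z + Im z else 0)"
  by (cases r) (auto simp: herm_coord_def axis_def)

lemma trace_axis: "trace (axis p (axis q z)) = (if p = q then z else 0 :: complex)"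
  by (simp add: trace_def axis_def if_distrib[of "\<lambda>x. x $ _"] cong: if_cong)

lemma hermitian_add: "hermitian A \<Longrightarrow> hermitian B \<Longrightarrow> hermitian (A + B)"
  unfolding hermitian_def by (metis complex_cnj_add vector_add_component)

lemma hermitian_axis_diag: "hermitian (axis p (axis p 1))"
  unfolding hermitian_def by (auto simp: axis_def)

lemma hermitian_axis_off: "p \<noteq> q \<Longrightarrow> hermitian (axis p (axis q z) + axis q (axis p (cnj z)))"
  unfolding hermitian_def by (auto simp: axis_def)

text \<open>Points dual to the coordinates other than the one at \<open>(p0, p0)\<close>. Real plus
  imaginary part is 1 for \<open>(1 + \<i>) / 2\<close> and 0 for its conjugate, so only one of the
  two mirrored coordinates sees the off-diagonal entries; the summand at \<open>p0\<close> makes the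
  trace 1.\<close>

definition herm_point :: "'c \<Rightarrow> 'c \<times> 'c \<Rightarrow> complex ^ 'c ^ 'c::finite" where
  "herm_point p0 r = (if fst r = snd r then axis (fst r) (axis (fst r) 1)
     else axis p0 (axis p0 1) + (axis (fst r) (axis (snd r) ((1 + \<i>) / 2)) +
       axis (snd r) (axis (fst r) (cnj ((1 + \<i>) / 2)))))"

lemma herm_point_plane: "herm_point p0 r \<in> herm_plane"
  by (auto simp: herm_plane_def herm_point_def trace_add trace_axis
      simp del: complex_cnj_divide intro!: hermitian_add hermitian_axis_diag hermitian_axis_off)

lemma herm_coord_point:
  assumes "s \<noteq> (p0, p0)"
  shows "herm_coord s (herm_point p0 r) = (if r = s then 1 else 0)"
  using assms by (cases r) (auto simp: herm_point_def herm_coord_add herm_coord_axis)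

text \<open>The coordinate at \<open>(p0, p0)\<close> is left out because the trace condition
  determines it.\<close>

lemma off_corner_list:
  fixes p0 :: "'c::finite"
  obtains rs where "distinct rs" "set rs = UNIV - {(p0, p0)}" "length rs = CARD('c) ^ 2 - 1"
proof -
  obtain rs where rs: "set rs = UNIV - {(p0, p0)}" "distinct rs"
    using finite_distinct_list[of "UNIV - {(p0, p0)}"] by auto
  then have "length rs = card (UNIV - {(p0, p0)})" using distinct_card by metis
  then have "length rs = CARD('c) ^ 2 - 1" by (simp add: card_Diff_singleton power2_eq_square)
  with rs show ?thesis by (intro that)
qed

lemma herm_plane_prime_chain:
  "\<exists>P. (\<forall>i\<le>CARD('c) ^ 2 - 1. primeideal (P i) poly_fun_ring \<and>
      vanishing_ideal (herm_plane :: (complex ^ 'c ^ 'c::finite) set) \<subseteq> P i) \<and>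
    (\<forall>i<CARD('c) ^ 2 - 1. P i \<subset> P (Suc i))"
proof -
  fix p0 :: 'c
  obtain rs where rs: "distinct rs" "set rs = UNIV - {(p0, p0)}" "length rs = CARD('c) ^ 2 - 1"
    by (rule off_corner_list)
  let ?m = "CARD('c) ^ 2 - 1"
  \<comment> \<open>The last point, belonging to \<open>(p0, p0)\<close>, has all coordinates in
    \<open>rs\<close> equal to 0; it shows that the smallest subspace of the flag is
    nonempty.\<close>
  let ?ws = "rs @ [(p0, p0)]"
  have dist: "distinct ?ws" using rs by simp
  have ne: "rs ! j \<noteq> (p0, p0)" if "j < ?m" for j using rs nth_mem[of j rs] that by auto
  have eq: "?ws ! i = rs ! j \<longleftrightarrow> i = j" if "i \<le> ?m" "j < ?m" for i j
    using nth_eq_iff_index_eq[OF dist, of i j] that rs(3) by (simp add: nth_append)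
  show ?thesis
  proof (rule affine_prime_chain[OF affine_herm_plane,
        where l = "\<lambda>i. herm_coord (rs ! i)" and w = "\<lambda>i. herm_point p0 (?ws ! i)"])
    show "herm_coord (rs ! j) (herm_point p0 (?ws ! i)) = 0" if "i \<le> ?m" "j < i" for i j
      using that ne[of j] eq[of i j] by (simp add: herm_coord_point)
    show "herm_coord (rs ! i) (herm_point p0 (?ws ! i)) \<noteq> 0" if "i < ?m" for i
      using that ne[of i] eq[of i i] by (simp add: herm_coord_point)
  qed (simp_all add: bounded_linear_herm_coord herm_point_plane)
qed

text \<open>On the plane all entries are polynomials in the \<open>CARD('c) ^ 2 - 1\<close> listed
  coordinates, so \<open>prime_chain_length_le\<close> applies with the identity as parametrisation
  and denominator 1.\<close>

lemma herm_plane_chain_length_le: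
  fixes P :: "nat \<Rightarrow> (complex ^ 'c ^ 'c::finite \<Rightarrow> real) set"
  assumes prime: "\<And>i. i \<le> k \<Longrightarrow> primeideal (P i) poly_fun_ring"
    and strict: "\<And>i. i < k \<Longrightarrow> P i \<subset> P (Suc i)"
    and vanish: "vanishing_ideal herm_plane \<subseteq> P 0"
  shows "k \<le> CARD('c) ^ 2 - 1"
proof -
  fix p0 :: 'c
  let ?L = "herm_plane :: (complex ^ 'c ^ 'c) set"
  obtain rs where rs: "distinct rs" "set rs = UNIV - {(p0, p0)}" "length rs = CARD('c) ^ 2 - 1"
    by (rule off_corner_list)
  let ?ys = "map herm_coord rs :: (complex ^ 'c ^ 'c \<Rightarrow> real) list"
  have other: "poly_in ?L ?ys (herm_coord r)" if "r \<noteq> (p0, p0)" for r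
    using rs(2) that by (intro poly_in_coord) auto
  have "poly_in ?L ?ys (herm_coord (p0, p0))"
  proof (rule poly_in_cong)
    show "poly_in ?L ?ys (\<lambda>A. 1 - (\<Sum>p\<in>UNIV - {p0}. herm_coord (p, p) A))"
      by (intro poly_in_intros other) auto
    fix A assume A: "A \<in> ?L"
    have im: "Im (A $ p $ p) = 0" for p
    proof -
      have "cnj (A $ p $ p) = A $ p $ p" using A by (intro hermitianD) (simp add: herm_plane_def)
      then show ?thesis by (metis Reals_cnj_iff complex_is_Real_iff)
    qed
    have "1 = Re (trace A)" using A by (simp add: herm_plane_def)
    also have "\<dots> = (\<Sum>p\<in>UNIV. herm_coord (p, p) A)" by (simp add: trace_def herm_coord_def im)
    also have "\<dots> = herm_coord (p0, p0) A + (\<Sum>p\<in>UNIV - {p0}. herm_coord (p, p) A)"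
      by (rule sum.remove) auto
    finally show "1 - (\<Sum>p\<in>UNIV - {p0}. herm_coord (p, p) A) = herm_coord (p0, p0) A" by simp
  qed
  with other have coord: "poly_in ?L ?ys (herm_coord r)" for r by (cases "r = (p0, p0)") auto
  have herm: "Re (A $ q $ p) = Re (A $ p $ q)" "Im (A $ q $ p) = - Im (A $ p $ q)" if "A \<in> ?L" for A p q
    using hermitianD[of A p q] that by (auto simp: herm_plane_def complex_eq_iff)
  have re: "poly_in ?L ?ys (\<lambda>A. Re (A $ p $ q))" for p q
  proof (rule poly_in_cong)
    show "poly_in ?L ?ys (\<lambda>A. 1 / 2 * (herm_coord (p, q) A + herm_coord (q, p) A))"
      by (intro poly_in_intros coord)
    show "1 / 2 * (herm_coord (p, q) A + herm_coord (q, p) A) = Re (A $ p $ q)" if "A \<in> ?L" for A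
      using herm[OF that, where p = p and q = q] by (simp add: herm_coord_def)
  qed
  have im: "poly_in ?L ?ys (\<lambda>A. Im (A $ p $ q))" for p q
  proof (rule poly_in_cong)
    show "poly_in ?L ?ys (\<lambda>A. 1 / 2 * (herm_coord (p, q) A - herm_coord (q, p) A))"
      by (intro poly_in_intros coord)
    show "1 / 2 * (herm_coord (p, q) A - herm_coord (q, p) A) = Im (A $ p $ q)" if "A \<in> ?L" for A
      using herm[OF that, where p = p and q = q] by (simp add: herm_coord_def)
  qed
  have "k \<le> length ?ys"
  proof (rule prime_chain_length_le[where T = ?L and \<psi> = "\<lambda>A. A" and n = "\<lambda>_. 1"])
    show "poly_in ?L ?ys (\<lambda>A. 1 * f A)" if f: "bounded_linear f" for f
    proof (rule poly_in_cong)
      show "poly_in ?L ?ys (\<lambda>A. \<Sum>p\<in>UNIV. \<Sum>q\<in>UNIV.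
          Re (A $ p $ q) * f (axis p (axis q 1)) + Im (A $ p $ q) * f (axis p (axis q \<i>)))"
        by (intro poly_in_sum poly_in_add poly_in_mult poly_in_const re im)
    qed (simp only: mult_1 bounded_linear_matrix_expand[OF f, symmetric])
  qed (use assms in \<open>auto intro: poly_in_const\<close>)
  then show ?thesis using rs by simp
qed


section \<open>Upper bound for states of bounded length\<close>

lemma tensor_vec_nth: "tensor_vec x y $ p = x $ fst p * y $ snd p"
  by (simp add: tensor_vec_def)

lemma ket_bra_nth: "ket_bra z $ p $ q = z $ p * cnj (z $ q)"
  by (simp add: ket_bra_def)

section \<open>Finitely many charts for the states of bounded length\<close>

definition poly_in_complex :: "'t set \<Rightarrow> ('t \<Rightarrow> real) list \<Rightarrow> ('t \<Rightarrow> complex) \<Rightarrow> bool" where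
  "poly_in_complex T ys f \<longleftrightarrow> poly_in T ys (\<lambda>t. Re (f t)) \<and> poly_in T ys (\<lambda>t. Im (f t))"

lemma poly_in_complex_mult:
  "poly_in_complex T ys f \<Longrightarrow> poly_in_complex T ys g \<Longrightarrow> poly_in_complex T ys (\<lambda>t. f t * g t)"
  by (simp add: poly_in_complex_def poly_in_add poly_in_diff poly_in_mult)

lemma poly_in_complex_cnj: "poly_in_complex T ys f \<Longrightarrow> poly_in_complex T ys (\<lambda>t. cnj (f t))"
  by (simp add: poly_in_complex_def poly_in_minus)

text \<open>Each factor is divided by a nonzero entry. The scalar \<open>c\<close> taken out enters
  the projector only through its squared modulus, so its phase is lost and a single real weight
  remains.\<close>

lemma product_vector_chart:
  fixes z :: "('a::finite, 'b::finite) bivec"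
  assumes "product_vector z"
  obtains s :: real and x y i j where "x $ i = 1" "y $ j = 1" "ket_bra z = s *\<^sub>R ket_bra (tensor_vec x y)"
proof -
  obtain x y where z: "z = tensor_vec x y" "z \<noteq> 0" using assms by (auto simp: product_vector_def)
  then obtain p where "z $ p \<noteq> 0" by (metis vec_eq_iff zero_index)
  with z have nz: "x $ fst p \<noteq> 0" "y $ snd p \<noteq> 0" by (auto simp: tensor_vec_nth)
  define c where "c = x $ fst p * y $ snd p"
  have c: "c \<noteq> 0" using nz by (simp add: c_def)
  have z': "z = c *s tensor_vec ((1 / x $ fst p) *s x) ((1 / y $ snd p) *s y)"
    using nz by (simp add: z vec_eq_iff tensor_vec_nth c_def)
  have "ket_bra z = (cmod c)\<^sup>2 *\<^sub>R ket_bra (tensor_vec ((1 / x $ fst p) *s x) ((1 / y $ snd p) *s y))"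
    (is "_ = _ *\<^sub>R ket_bra ?w")
  proof -
    have "z $ q * cnj (z $ r) = (cmod c)\<^sup>2 *\<^sub>R (?w $ q * cnj (?w $ r))" for q r
    proof -
      have "z $ q * cnj (z $ r) = (c * cnj c) * (?w $ q * cnj (?w $ r))" by (simp add: z')
      then show ?thesis by (simp only: complex_norm_square[symmetric] scaleR_conv_of_real)
    qed
    then show ?thesis by (simp add: vec_eq_iff ket_bra_nth)
  qed
  with nz show ?thesis
    by (intro that[of "(1 / x $ fst p) *s x" "fst p" "(1 / y $ snd p) *s y" "snd p"]) auto
qed

lemma vanishing_ideal_antimono: "A \<subseteq> B \<Longrightarrow> vanishing_ideal B \<subseteq> vanishing_ideal A"
  by (auto simp: vanishing_ideal_def)

lemma sep_states_plane: "sep_states_le r \<subseteq> herm_plane"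
  by (auto simp: sep_states_le_def sep_states_def separable_def is_state_def pos_semidef_def herm_plane_def)

type_synonym ('a, 'b) chart_params = "nat \<Rightarrow> real \<times> (complex ^ 'a) \<times> (complex ^ 'b)"

definition prod_vec :: "('a, 'b) chart_params \<Rightarrow> nat \<Rightarrow> ('a::finite, 'b::finite) bivec" where
  "prod_vec t k = tensor_vec (fst (snd (t k))) (snd (snd (t k)))"

definition chart_map :: "nat \<Rightarrow> ('a, 'b) chart_params \<Rightarrow> ('a::finite, 'b::finite) biop" where
  "chart_map r t = (\<Sum>k<r. fst (t k) *\<^sub>R ket_bra (prod_vec t k))"

text \<open>In the chart \<open>c\<close> the vectors of the \<open>k\<close>-th product are normalised to have the entry 1 at
  the two components of \<open>c k\<close>, and the trace condition determines the weight of the 0-th product.\<close>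

definition chart_dom :: "nat \<Rightarrow> (nat \<Rightarrow> 'a \<times> 'b) \<Rightarrow> ('a::finite, 'b::finite) chart_params set" where
  "chart_dom r c = {t. (\<forall>k<r. fst (snd (t k)) $ fst (c k) = 1 \<and> snd (snd (t k)) $ snd (c k) = 1) \<and>
    trace (chart_map r t) = 1}"

lemma sep_states_charts:
  "sep_states_le r \<subseteq> (\<Union>c\<in>PiE {..<r} (\<lambda>_. UNIV). chart_map r ` chart_dom r c)"
proof
  fix \<rho> :: "('a, 'b) biop"
  assume \<rho>: "\<rho> \<in> sep_states_le r"
  then have tr: "trace \<rho> = 1" and ex: "\<exists>l. product_decomp \<rho> l" and le: "state_length \<rho> \<le> r"
    by (auto simp: sep_states_le_def sep_states_def separable_def)
  define l where "l = state_length \<rho>"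
  have "product_decomp \<rho> l" unfolding l_def state_length_def using ex by (rule LeastI_ex)
  then obtain z where z: "\<And>k. k < l \<Longrightarrow> product_vector (z k)" "\<rho> = (\<Sum>k<l. ket_bra (z k))"
    by (auto simp: product_decomp_def)
  have "\<exists>u c. fst (snd u) $ fst c = 1 \<and> snd (snd u) $ snd c = 1 \<and>
    fst u *\<^sub>R ket_bra (tensor_vec (fst (snd u)) (snd (snd u))) = (if k < l then ket_bra (z k) else 0)" for k
  proof (cases "k < l")
    case True
    obtain s x y i j where "x $ i = 1" "y $ j = 1" "ket_bra (z k) = s *\<^sub>R ket_bra (tensor_vec x y)"
      using product_vector_chart[OF z(1)[OF True]] by metis
    then show ?thesis using True by (intro exI[of _ "(s, x, y)"] exI[of _ "(i, j)"]) simp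
  next
    case False
    \<comment> \<open>Padding: all entries are 1, so any component can serve as the normalised one,
      including \<open>undefined\<close>.\<close>
    then show ?thesis by (intro exI[of _ "(0, \<chi> _. 1, \<chi> _. 1)"] exI[of _ undefined]) simp
  qed
  then obtain t c where tc: "\<And>k. fst (snd (t k)) $ fst (c k) = 1" "\<And>k. snd (snd (t k)) $ snd (c k) = 1"
    "\<And>k. fst (t k) *\<^sub>R ket_bra (tensor_vec (fst (snd (t k))) (snd (snd (t k)))) = (if k < l then ket_bra (z k) else 0)"
    by metis
  have "chart_map r t = (\<Sum>k<r. if k < l then ket_bra (z k) else 0)"
    by (simp add: chart_map_def prod_vec_def tc(3))
  also have "\<dots> = (\<Sum>k<l. ket_bra (z k))"
    using le by (intro sum.mono_neutral_cong_right) (auto simp: l_def)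
  finally have map: "chart_map r t = \<rho>" using z(2) by simp
  with tr tc have "t \<in> chart_dom r (restrict c {..<r})" by (simp add: chart_dom_def)
  moreover have "restrict c {..<r} \<in> PiE {..<r} (\<lambda>_. UNIV)" by auto
  ultimately show "\<rho> \<in> (\<Union>c\<in>PiE {..<r} (\<lambda>_. UNIV). chart_map r ` chart_dom r c)" using map by blast
qed

definition sq_norm :: "complex ^ 'c \<Rightarrow> real" where
  "sq_norm z = (\<Sum>p\<in>UNIV. (Re (z $ p))\<^sup>2 + (Im (z $ p))\<^sup>2)"

lemma trace_ket_bra: "trace (ket_bra z) = of_real (sq_norm z)"
  by (simp add: trace_def ket_bra_nth sq_norm_def complex_mult_cnj)

lemma sq_norm_pos: "z $ p \<noteq> 0 \<Longrightarrow> 0 < sq_norm (z :: complex ^ 'c::finite)"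
  unfolding sq_norm_def
  by (rule sum_pos2[of _ p]) (auto simp: complex_eq_iff sum_power2_gt_zero_iff)

text \<open>Weights start at index 1, since the trace fixes weight 0. The lists \<open>as k\<close>
  and \<open>bs k\<close> are meant to hold the components that the chart leaves free.\<close>

definition chart_coords :: "nat \<Rightarrow> (nat \<Rightarrow> 'a list) \<Rightarrow> (nat \<Rightarrow> 'b list) \<Rightarrow>
    (('a::finite, 'b::finite) chart_params \<Rightarrow> real) list" where
  "chart_coords r as bs = map (\<lambda>k t. fst (t k)) [1..<r] @
     concat (map (\<lambda>k. concat (map (\<lambda>i. [\<lambda>t. Re (fst (snd (t k)) $ i), \<lambda>t. Im (fst (snd (t k)) $ i)]) (as k)) @
        concat (map (\<lambda>j. [\<lambda>t. Re (snd (snd (t k)) $ j), \<lambda>t. Im (snd (snd (t k)) $ j)]) (bs k))) [0..<r])"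

lemma length_chart_coords:
  assumes "\<And>k. length (as k) = m" "\<And>k. length (bs k) = n"
  shows "length (chart_coords r as bs) = r - 1 + r * (2 * m + 2 * n)"
  by (simp add: chart_coords_def length_concat o_def sum_list_triv assms)

text \<open>By the trace condition, weight 0 is a polynomial in the chart coordinates divided by the
  squared norm of the 0-th product, which is nonzero because one entry is 1. So the chart is a
  rational parametrisation with this denominator, and the bound counts its free coordinates.\<close>

lemma chart_chain_length_le:
  fixes P :: "nat \<Rightarrow> (('a::finite, 'b::finite) biop \<Rightarrow> real) set" and c :: "nat \<Rightarrow> 'a \<times> 'b"
  assumes prime: "\<And>i. i \<le> k \<Longrightarrow> primeideal (P i) poly_fun_ring"
    and strict: "\<And>i. i < k \<Longrightarrow> P i \<subset> P (Suc i)"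
    and vanish: "vanishing_ideal (chart_map r ` chart_dom r c) \<subseteq> P 0"
    and r: "0 < r"
  shows "k \<le> r - 1 + r * (2 * (CARD('a) - 1) + 2 * (CARD('b) - 1))"
proof -
  let ?T = "chart_dom r c"
  have "\<exists>l. set l = UNIV - {i} \<and> length l = CARD('a) - 1" for i :: 'a
    by (metis List.finite_set card_Diff_singleton distinct_card finite finite_distinct_list UNIV_I)
  then obtain la where la: "\<And>i::'a. set (la i) = UNIV - {i}" "\<And>i. length (la i) = CARD('a) - 1" by metis
  have "\<exists>l. set l = UNIV - {i} \<and> length l = CARD('b) - 1" for i :: 'b
    by (metis List.finite_set card_Diff_singleton distinct_card finite finite_distinct_list UNIV_I)
  then obtain lb where lb: "\<And>i::'b. set (lb i) = UNIV - {i}" "\<And>i. length (lb i) = CARD('b) - 1" by metis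
  define ys where "ys = chart_coords r (\<lambda>k. la (fst (c k))) (\<lambda>k. lb (snd (c k)))"
  have len: "length ys = r - 1 + r * (2 * (CARD('a) - 1) + 2 * (CARD('b) - 1))"
    unfolding ys_def by (rule length_chart_coords) (simp_all add: la lb)
  have s: "poly_in ?T ys (\<lambda>t. fst (t k))" if "1 \<le> k" "k < r" for k
    using that by (intro poly_in_coord) (auto simp: ys_def chart_coords_def)
  have x: "poly_in_complex ?T ys (\<lambda>t. fst (snd (t k)) $ i)" if k: "k < r" for k i
  proof (cases "i = fst (c k)")
    case True
    have "poly_in ?T ys (\<lambda>t. Re (fst (snd (t k)) $ i))"
      using k True by (intro poly_in_cong[OF poly_in_const[of _ _ 1]]) (auto simp: chart_dom_def)
    moreover have "poly_in ?T ys (\<lambda>t. Im (fst (snd (t k)) $ i))"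
      using k True by (intro poly_in_cong[OF poly_in_const[of _ _ 0]]) (auto simp: chart_dom_def)
    ultimately show ?thesis by (simp add: poly_in_complex_def)
  next
    case False
    then have "i \<in> set (la (fst (c k)))" by (simp add: la)
    with k show ?thesis unfolding poly_in_complex_def
      by (intro conjI poly_in_coord) (fastforce simp: ys_def chart_coords_def)+
  qed
  have y: "poly_in_complex ?T ys (\<lambda>t. snd (snd (t k)) $ i)" if k: "k < r" for k i
  proof (cases "i = snd (c k)")
    case True
    have "poly_in ?T ys (\<lambda>t. Re (snd (snd (t k)) $ i))"
      using k True by (intro poly_in_cong[OF poly_in_const[of _ _ 1]]) (auto simp: chart_dom_def)
    moreover have "poly_in ?T ys (\<lambda>t. Im (snd (snd (t k)) $ i))"
      using k True by (intro poly_in_cong[OF poly_in_const[of _ _ 0]]) (auto simp: chart_dom_def)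
    ultimately show ?thesis by (simp add: poly_in_complex_def)
  next
    case False
    then have "i \<in> set (lb (snd (c k)))" by (simp add: lb)
    with k show ?thesis unfolding poly_in_complex_def
      by (intro conjI poly_in_coord) (fastforce simp: ys_def chart_coords_def)+
  qed
  have z: "poly_in_complex ?T ys (\<lambda>t. prod_vec t k $ p)" if "k < r" for k p
    unfolding prod_vec_def tensor_vec_nth by (intro poly_in_complex_mult x y that)
  have kb: "poly_in_complex ?T ys (\<lambda>t. ket_bra (prod_vec t k) $ p $ q)" if "k < r" for k p q
    unfolding ket_bra_nth by (intro poly_in_complex_mult poly_in_complex_cnj z that)
  have n: "poly_in ?T ys (\<lambda>t. sq_norm (prod_vec t k))" if "k < r" for k
    unfolding sq_norm_def using z[OF that]
    by (intro poly_in_sum poly_in_add poly_in_power) (auto simp: poly_in_complex_def)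
  have s0: "poly_in ?T ys (\<lambda>t. sq_norm (prod_vec t 0) * fst (t 0))"
  proof (rule poly_in_cong)
    show "poly_in ?T ys (\<lambda>t. 1 - (\<Sum>k\<in>{..<r} - {0}. fst (t k) * sq_norm (prod_vec t k)))"
      by (intro poly_in_intros s n) auto
    fix t assume "t \<in> ?T"
    then have "1 = trace (chart_map r t)" by (simp add: chart_dom_def)
    also have "\<dots> = (\<Sum>k<r. fst (t k) *\<^sub>R trace (ket_bra (prod_vec t k)))"
      unfolding chart_map_def trace_def by (simp add: sum_component scaleR_right.sum) (rule sum.swap)
    also have "\<dots> = of_real (\<Sum>k<r. fst (t k) * sq_norm (prod_vec t k))"
      by (simp add: trace_ket_bra scaleR_conv_of_real)
    finally have "1 = (\<Sum>k<r. fst (t k) * sq_norm (prod_vec t k))"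
      by (metis of_real_1 of_real_eq_iff)
    also have "\<dots> = fst (t 0) * sq_norm (prod_vec t 0) + (\<Sum>k\<in>{..<r} - {0}. fst (t k) * sq_norm (prod_vec t k))"
      by (rule sum.remove) (use r in auto)
    finally show "1 - (\<Sum>k\<in>{..<r} - {0}. fst (t k) * sq_norm (prod_vec t k)) = sq_norm (prod_vec t 0) * fst (t 0)"
      by (simp add: mult.commute)
  qed
  have entry: "poly_in ?T ys (\<lambda>t. sq_norm (prod_vec t 0) * g (chart_map r t))"
    if g: "bounded_linear g" and gk: "\<And>k. k < r \<Longrightarrow> poly_in ?T ys (\<lambda>t. g (ket_bra (prod_vec t k)))" for g
  proof (rule poly_in_cong)
    show "poly_in ?T ys (\<lambda>t. (sq_norm (prod_vec t 0) * fst (t 0)) * g (ket_bra (prod_vec t 0)) +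
      (\<Sum>k\<in>{..<r} - {0}. sq_norm (prod_vec t 0) * (fst (t k) * g (ket_bra (prod_vec t k)))))"
      using r by (intro poly_in_add poly_in_sum poly_in_mult s0 n gk s) auto
    fix t
    interpret bounded_linear g by (rule g)
    have "g (chart_map r t) = (\<Sum>k<r. fst (t k) * g (ket_bra (prod_vec t k)))"
      by (simp add: chart_map_def sum scaleR)
    also have "\<dots> = fst (t 0) * g (ket_bra (prod_vec t 0)) + (\<Sum>k\<in>{..<r} - {0}. fst (t k) * g (ket_bra (prod_vec t k)))"
      by (rule sum.remove) (use r in auto)
    finally show "(sq_norm (prod_vec t 0) * fst (t 0)) * g (ket_bra (prod_vec t 0)) +
      (\<Sum>k\<in>{..<r} - {0}. sq_norm (prod_vec t 0) * (fst (t k) * g (ket_bra (prod_vec t k)))) =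
      sq_norm (prod_vec t 0) * g (chart_map r t)"
      by (simp add: algebra_simps sum_distrib_left)
  qed
  have "k \<le> length ys"
  proof (rule prime_chain_length_le[where T = ?T and \<psi> = "chart_map r" and n = "\<lambda>t. sq_norm (prod_vec t 0)"])
    fix t assume "t \<in> ?T"
    then have "prod_vec t 0 $ c 0 \<noteq> 0" using r by (simp add: prod_vec_def tensor_vec_nth chart_dom_def)
    from sq_norm_pos[OF this] show "sq_norm (prod_vec t 0) \<noteq> 0" by simp
  next
    fix g :: "('a, 'b) biop \<Rightarrow> real" assume g: "bounded_linear g"
    show "poly_in ?T ys (\<lambda>t. sq_norm (prod_vec t 0) * g (chart_map r t))"
    proof (rule entry[OF g])
      fix k assume k: "k < r"
      show "poly_in ?T ys (\<lambda>t. g (ket_bra (prod_vec t k)))"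
      proof (rule poly_in_cong)
        show "poly_in ?T ys (\<lambda>t. \<Sum>p\<in>UNIV. \<Sum>q\<in>UNIV.
            Re (ket_bra (prod_vec t k) $ p $ q) * g (axis p (axis q 1)) +
            Im (ket_bra (prod_vec t k) $ p $ q) * g (axis p (axis q \<i>)))"
          using kb[OF k] unfolding poly_in_complex_def
          by (intro poly_in_sum poly_in_add poly_in_mult poly_in_const) auto
      qed (simp only: bounded_linear_matrix_expand[OF g, symmetric])
    qed
  qed (use prime strict vanish n r in auto)
  with len show ?thesis by simp
qed

text \<open>A prime containing the vanishing ideal of the finite union of chart images contains that
  of a single one, whose bound then applies.\<close>

lemma sep_states_chain_length_le:
  fixes P :: "nat \<Rightarrow> (('a::finite, 'b::finite) biop \<Rightarrow> real) set"
  assumes prime: "\<And>i. i \<le> k \<Longrightarrow> primeideal (P i) poly_fun_ring"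
    and strict: "\<And>i. i < k \<Longrightarrow> P i \<subset> P (Suc i)"
    and vanish: "vanishing_ideal (sep_states_le r :: ('a, 'b) biop set) \<subseteq> P 0"
    and r: "0 < r"
  shows "k \<le> r - 1 + r * (2 * (CARD('a) - 1) + 2 * (CARD('b) - 1))"
proof -
  let ?C = "PiE {..<r} (\<lambda>_. UNIV :: ('a \<times> 'b) set)"
  have "vanishing_ideal (\<Union>c\<in>?C. chart_map r ` chart_dom r c) \<subseteq> P 0"
    using vanishing_ideal_antimono[OF sep_states_charts] vanish by (rule subset_trans)
  then obtain c where "vanishing_ideal (chart_map r ` chart_dom r c) \<subseteq> P 0"
    using vanishing_ideal_UN_prime[OF prime[of 0], of ?C "\<lambda>c. chart_map r ` chart_dom r c"]
    by (auto simp: finite_PiE)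
  with r prime strict show ?thesis by (intro chart_chain_length_le[where P = P]) auto
qed


section \<open>Product vectors with spanning tangent spaces\<close>

text \<open>The polarisation of \<open>ket_bra\<close>, to which the product rule applies.\<close>

definition outer :: "complex ^ 'c \<Rightarrow> complex ^ 'c \<Rightarrow> complex ^ 'c ^ 'c" where
  "outer z w = (\<chi> p q. z $ p * cnj (w $ q))"

definition adj :: "complex ^ 'c ^ 'c \<Rightarrow> complex ^ 'c ^ 'c" where
  "adj A = (\<chi> p q. cnj (A $ q $ p))"

lemma ket_bra_outer: "ket_bra z = outer z z"
  by (simp add: ket_bra_def outer_def)

lemma hermitian_adj: "hermitian A \<longleftrightarrow> adj A = A"
  by (simp add: hermitian_def adj_def vec_eq_iff) metis

lemma adj_diff: "adj (A - B) = adj A - adj B"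
  by (simp add: adj_def vec_eq_iff)

lemma adj_adj: "adj (adj A) = A"
  by (simp add: adj_def vec_eq_iff)

lemma hermitian_ket_bra: "hermitian (ket_bra z)"
  by (simp add: hermitian_def ket_bra_nth)

lemma hermitian_sum: "(\<And>i. i \<in> S \<Longrightarrow> hermitian (A i)) \<Longrightarrow> hermitian (\<Sum>i\<in>S. A i)"
  by (induction S rule: infinite_finite_induct) (auto intro: hermitian_add simp: hermitian_def[of 0])

lemma hermitian_scaleR: "hermitian A \<Longrightarrow> hermitian (c *\<^sub>R A)"
  by (simp add: hermitian_adj adj_def vec_eq_iff)

lemma trace_scaleR: "trace (c *\<^sub>R A) = c *\<^sub>R trace (A :: complex ^ 'c ^ 'c::finite)"
  by (simp add: trace_def scaleR_right.sum)

lemma trace_sum: "trace (\<Sum>i\<in>S. A i) = (\<Sum>i\<in>S. trace (A i :: complex ^ 'c ^ 'c::finite))"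
  unfolding trace_def by (simp add: sum_component) (rule sum.swap)

lemma ket_bra_scaleR: "ket_bra (c *\<^sub>R z) = c\<^sup>2 *\<^sub>R ket_bra z"
  by (simp add: ket_bra_def vec_eq_iff power2_eq_square)

lemma tensor_vec_scaleR: "tensor_vec (c *\<^sub>R x) y = c *\<^sub>R tensor_vec x y"
  by (simp add: tensor_vec_nth vec_eq_iff)

text \<open>The quadratic form of \<open>ket_bra z\<close> at \<open>v\<close> is the squared
  modulus of the inner product \<open>c\<close> of \<open>z\<close> and \<open>v\<close>.\<close>

lemma pos_semidef_ket_bra: "0 \<le> Re (\<Sum>p\<in>UNIV. cnj (v $ p) * (ket_bra z *v v) $ p)"
  for z v :: "complex ^ 'c::finite"
proof -
  define c where "c = (\<Sum>q\<in>UNIV. cnj (z $ q) * v $ q)"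
  have "(ket_bra z *v v) $ p = z $ p * c" for p
    by (simp add: matrix_vector_mult_def ket_bra_nth c_def sum_distrib_left mult_ac)
  then have "(\<Sum>p\<in>UNIV. cnj (v $ p) * (ket_bra z *v v) $ p) = (\<Sum>p\<in>UNIV. cnj (v $ p) * z $ p) * c"
    by (simp add: sum_distrib_left sum_distrib_right mult_ac)
  also have "(\<Sum>p\<in>UNIV. cnj (v $ p) * z $ p) = cnj c"
    by (simp add: c_def mult_ac)
  finally show ?thesis by (simp add: mult_ac complex_mult_cnj)
qed

lemma pos_semidef_sum_ket_bra: "finite S \<Longrightarrow> pos_semidef (\<Sum>i\<in>S. ket_bra (z i))"
  for z :: "'i \<Rightarrow> complex ^ 'c::finite"
proof -
  assume S: "finite S"
  have "0 \<le> Re (\<Sum>p\<in>UNIV. cnj (v $ p) * ((\<Sum>i\<in>S. ket_bra (z i)) *v v) $ p)" for v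
    using S
  proof (induction S rule: finite_induct)
    case (insert i S)
    then show ?case using pos_semidef_ket_bra[of v "z i"]
      by (simp add: matrix_vector_mult_add_rdistrib distrib_left sum.distrib)
  qed simp
  then show ?thesis unfolding pos_semidef_def by (intro conjI allI hermitian_sum hermitian_ket_bra)
qed

text \<open>Product vectors must be nonzero, so vanishing terms are dropped and the remaining ones
  renumbered; this can only shorten the decomposition.\<close>

lemma sep_states_le_sum:
  fixes x :: "'i::finite \<Rightarrow> complex ^ 'a::finite" and y :: "'i \<Rightarrow> complex ^ 'b::finite"
  assumes \<rho>: "\<rho> = (\<Sum>i\<in>UNIV. ket_bra (tensor_vec (x i) (y i)))" and tr: "trace \<rho> = 1"
  shows "\<rho> \<in> sep_states_le (CARD('i))"
proof -
  let ?z = "\<lambda>i. tensor_vec (x i) (y i)"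
  define S where "S = {i. ?z i \<noteq> 0}"
  have "ket_bra 0 = (0 :: ('a, 'b) biop)" by (simp add: ket_bra_def vec_eq_iff)
  then have \<rho>S: "\<rho> = (\<Sum>i\<in>S. ket_bra (?z i))"
    unfolding \<rho> by (intro sum.mono_neutral_right) (auto simp: S_def)
  obtain h where h: "bij_betw h {0..<card S} S" using ex_bij_betw_nat_finite[of S] by auto
  then have "\<rho> = (\<Sum>k<card S. ket_bra (?z (h k)))"
    unfolding \<rho>S by (simp add: sum.reindex_bij_betw[OF h, symmetric] atLeast0LessThan)
  moreover have "product_vector (?z (h k))" if "k < card S" for k
    using bij_betwE[OF h] that by (auto simp: S_def product_vector_def)
  ultimately have dec: "product_decomp \<rho> (card S)"
    unfolding product_decomp_def by (intro exI[of _ "\<lambda>k. ?z (h k)"]) simp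
  then have "state_length \<rho> \<le> card S" unfolding state_length_def by (rule Least_le)
  also have "\<dots> \<le> CARD('i)" by (intro card_mono) auto
  finally have "state_length \<rho> \<le> CARD('i)" .
  moreover have "\<rho> \<noteq> 0" using tr by (auto simp: trace_def)
  moreover have "pos_semidef \<rho>" unfolding \<rho> by (rule pos_semidef_sum_ket_bra) simp
  ultimately show ?thesis
    using tr dec by (auto simp: sep_states_le_def sep_states_def separable_def is_state_def)
qed

section \<open>Hermitian matrices orthogonal to the tangent spaces\<close>

text \<open>The form \<open><d|W|z>\<close>, conjugate linear in \<open>d\<close>.\<close>

definition sesq :: "complex ^ 'c ^ 'c \<Rightarrow> complex ^ 'c \<Rightarrow> complex ^ 'c \<Rightarrow> complex" where
  "sesq W d z = (\<Sum>p\<in>UNIV. \<Sum>q\<in>UNIV. cnj (d $ p) * W $ p $ q * z $ q)"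

text \<open>Turns orthogonality to a tangent direction into an equation for the form
  \<open>sesq W\<close>.\<close>

lemma inner_outer: "W \<bullet> outer d z = Re (sesq W d z)"
  for W :: "complex ^ 'c ^ 'c::finite"
proof -
  have "a \<bullet> b = Re (cnj b * a)" for a b :: complex
    by (simp add: inner_complex_def algebra_simps)
  note inner = this
  have "W \<bullet> outer d z = (\<Sum>p\<in>UNIV. \<Sum>q\<in>UNIV. Re (cnj (outer d z $ p $ q) * W $ p $ q))"
    by (simp only: inner_vec_def inner)
  moreover have outer_nth: "cnj (outer d z $ p $ q) * W $ p $ q = cnj (d $ p) * W $ p $ q * z $ q" for p q
    by (simp add: outer_def)
  ultimately show ?thesis
    by (simp only: outer_nth sesq_def Re_sum)
qed

lemma sesq_swap:
  fixes W :: "complex ^ 'c ^ 'c::finite"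
  assumes "hermitian W" shows "sesq W z d = cnj (sesq W d z)"
  unfolding sesq_def using hermitianD[OF assms]
  by (subst sum.swap) (simp add: mult_ac)

lemma sesq_cmult: "sesq W (c *s d) z = cnj c * sesq W d z"
  by (simp add: sesq_def sum_distrib_left mult_ac)

text \<open>Basis vectors in the second factor single out one block of \<open>W\<close>, which lets
  the equations be solved block by block.\<close>

lemma sesq_product:
  fixes W :: "('a::finite, 'b::finite) biop"
  shows "sesq W (tensor_vec u (axis i 1)) (tensor_vec x (axis j 1)) =
    (\<Sum>a\<in>UNIV. \<Sum>a'\<in>UNIV. cnj (u $ a) * W $ (a, i) $ (a', j) * x $ a')"
proof -
  have pair: "(\<Sum>p\<in>UNIV. f p) = (\<Sum>a\<in>UNIV. \<Sum>b\<in>UNIV. f (a, b))" for f :: "'a \<times> 'b \<Rightarrow> complex"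
    by (simp add: sum.cartesian_product)
  have "sesq W (tensor_vec u (axis i 1)) (tensor_vec x (axis j 1)) =
    (\<Sum>a\<in>UNIV. \<Sum>b\<in>UNIV. \<Sum>a'\<in>UNIV. \<Sum>b'\<in>UNIV.
      if b' = j then if b = i then cnj (u $ a) * W $ (a, b) $ (a', b') * x $ a' else 0 else 0)"
    unfolding sesq_def pair tensor_vec_nth by (intro sum.cong refl) (simp add: axis_def)
  also have "\<dots> = (\<Sum>a\<in>UNIV. \<Sum>b\<in>UNIV. \<Sum>a'\<in>UNIV.
      if b = i then cnj (u $ a) * W $ (a, b) $ (a', j) * x $ a' else 0)" by simp
  also have "\<dots> = (\<Sum>a\<in>UNIV. \<Sum>b\<in>UNIV. if b = i then
      (\<Sum>a'\<in>UNIV. cnj (u $ a) * W $ (a, b) $ (a', j) * x $ a') else 0)"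
    by (intro sum.cong refl) auto
  finally show ?thesis by simp
qed

text \<open>Vieta's relations for the roots \<open>P\<close> and \<open>Q\<close> of
  \<open>a + s X + d X^2\<close>, in a form without division because \<open>d\<close> may be
  0.\<close>

lemma quadratic_two_roots:
  fixes a s d :: complex
  assumes "a + P * s + P\<^sup>2 * d = 0" "a + Q * s + Q\<^sup>2 * d = 0" "P \<noteq> Q"
  shows "s = - (P + Q) * d" "a = P * Q * d"
proof -
  have "(P - Q) * (s + (P + Q) * d) = (a + P * s + P\<^sup>2 * d) - (a + Q * s + Q\<^sup>2 * d)"
    by (simp add: algebra_simps power2_eq_square)
  with assms have "s + (P + Q) * d = 0" by simp
  then show s: "s = - (P + Q) * d" by (metis eq_neg_iff_add_eq_0 mult_minus_left)
  have "a = - (P * s + P\<^sup>2 * d)" using assms(1) by (simp only: eq_neg_iff_add_eq_0 add.assoc)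
  then show "a = P * Q * d" by (simp add: s algebra_simps power2_eq_square)
qed

text \<open>The expression is, up to a linear change of coordinates, the general real circle or line
  equation in \<open>u\<close> (with complex coefficients), and the points \<open>P, Q, 2iP, 2iQ\<close> are not concyclic.\<close>

lemma circle_four_points:
  fixes a b c d :: complex and P Q :: real
  defines "E \<equiv> \<lambda>u. a + u * b + cnj u * c + cnj u * u * d"
  assumes "0 < P" "0 < Q" "P \<noteq> Q"
    and E: "E (of_real P) = 0" "E (of_real Q) = 0" "E (2 * of_real P * \<i>) = 0" "E (2 * of_real Q * \<i>) = 0"
  shows "a = 0" "b = 0" "c = 0" "d = 0"
proof -
  \<comment> \<open>At real \<open>u\<close> the expression is a quadratic with linear coefficient
    \<open>b + c\<close>; at \<open>u = 2 \<i> x\<close> with real \<open>x\<close> it is a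
    quadratic in \<open>2 x\<close> with linear coefficient \<open>\<i> * (b - c)\<close>.\<close>
  have "a + of_real P * (b + c) + (of_real P)\<^sup>2 * d = 0" "a + of_real Q * (b + c) + (of_real Q)\<^sup>2 * d = 0"
    using E(1,2) by (simp_all add: E_def algebra_simps power2_eq_square)
  note 1 = quadratic_two_roots[OF this]
  have "a + (2 * of_real P) * (\<i> * (b - c)) + (2 * of_real P)\<^sup>2 * d = 0"
    "a + (2 * of_real Q) * (\<i> * (b - c)) + (2 * of_real Q)\<^sup>2 * d = 0"
    using E(3,4) by (simp_all add: E_def algebra_simps power2_eq_square)
  note 2 = quadratic_two_roots[OF this]
  have PQ: "complex_of_real P \<noteq> of_real Q" "complex_of_real P \<noteq> 0" "complex_of_real Q \<noteq> 0"
    "2 * complex_of_real P \<noteq> 2 * of_real Q" using assms(2-4) by auto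
  \<comment> \<open>Both quadratics have constant term \<open>a\<close> and leading coefficient
    \<open>d\<close>, so \<open>a = P Q d\<close> and \<open>a = 4 P Q d\<close>.\<close>
  have "of_real P * of_real Q * d = 2 * of_real P * (2 * of_real Q) * d"
    using 1(2)[OF PQ(1)] 2(2)[OF PQ(4)] by simp
  then have "(3 * of_real P * of_real Q) * d = 0" by (simp add: algebra_simps)
  then show d: "d = 0" using PQ by simp
  then show "a = 0" using 1(2)[OF PQ(1)] by simp
  have "b + c = 0" "b - c = 0" using 1(1)[OF PQ(1)] 2(1)[OF PQ(4)] d by auto
  then show "b = 0" "c = 0" by auto
qed

text \<open>When \<open>'a\<close> has two elements, the index type \<open>'b \<times> 'a\<close>
  supplies two products for each element of \<open>'b\<close>; the second component is a label that
  chooses between their points.\<close>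

definition config_point :: "('b \<Rightarrow> real) \<Rightarrow> 'a \<Rightarrow> 'b \<times> 'a \<Rightarrow> complex" where
  "config_point p a0 k = (if snd k = a0 then of_real (p (fst k)) else 2 * of_real (p (fst k)) * \<i>)"

definition config_vec :: "('b \<Rightarrow> real) \<Rightarrow> 'a \<Rightarrow> 'b \<times> 'a \<Rightarrow> complex ^ 'a" where
  "config_vec p a0 k = (\<chi> a. if a = a0 then 1 else config_point p a0 k)"

text \<open>For \<open>W\<close> orthogonal to all tangent directions, each pair of indices \<open>i \<noteq> j\<close> of the second
  factor gives a separate system of four equations for four entries of \<open>W\<close>.\<close>

lemma config_no_witness:
  fixes W :: "('a::finite, 'b::finite) biop"
  assumes a: "UNIV = {a0, a1 :: 'a}" "a0 \<noteq> a1"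
    and p: "inj p" "\<And>j. 0 < p j"
    and W: "hermitian W"
    and left: "\<And>k u. sesq W (tensor_vec u (axis (fst k) 1)) (tensor_vec (config_vec p a0 k) (axis (fst k) 1)) = 0"
    and right: "\<And>k v. sesq W (tensor_vec (config_vec p a0 k) v) (tensor_vec (config_vec p a0 k) (axis (fst k) 1)) = 0"
  shows "W = 0"
proof -
  have sum2: "(\<Sum>a\<in>UNIV. f a) = f a0 + f a1" for f :: "'a \<Rightarrow> complex"
    using a(2) by (simp add: a(1))
  have vec: "config_vec p a0 k $ a0 = 1" "config_vec p a0 k $ a1 = config_point p a0 k" for k
    using a(2) by (simp_all add: config_vec_def)
  have pt: "config_point p a0 (j, a0) = of_real (p j)" "config_point p a0 (j, a1) = 2 * of_real (p j) * \<i>" for j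
    using a(2) by (simp_all add: config_point_def)
  \<comment> \<open>Row \<open>a\<close> of the \<open>j\<close>-th diagonal block annihilates
    \<open>(1, u)\<close> for the two distinct points \<open>u\<close> of index
    \<open>j\<close>.\<close>
  have diag: "W $ (a, j) $ (a', j) = 0" for a a' j
  proof -
    have eq: "W $ (a, j) $ (a0, j) + W $ (a, j) $ (a1, j) * config_point p a0 (j, s) = 0" for s
    proof -
      have *: "(\<Sum>b\<in>UNIV. \<Sum>a'\<in>UNIV. cnj (axis a 1 $ b) * W $ (b, j) $ (a', j) * config_vec p a0 (j, s) $ a') = 0"
        using left[where u = "axis a 1" and k = "(j, s)"] by (simp add: sesq_product)
      moreover have "a = a0 \<or> a = a1" using a(1) by blast
      ultimately show ?thesis
      proof (elim disjE)
        assume "a = a0"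
        with *[unfolded sum2 vec] show ?thesis using a(2) by (simp add: axis_def)
      next
        assume "a = a1"
        with *[unfolded sum2 vec] show ?thesis using a(2) by (simp add: axis_def)
      qed
    qed
    have "W $ (a, j) $ (a1, j) * (config_point p a0 (j, a0) - config_point p a0 (j, a1)) =
      (W $ (a, j) $ (a0, j) + W $ (a, j) $ (a1, j) * config_point p a0 (j, a0)) -
      (W $ (a, j) $ (a0, j) + W $ (a, j) $ (a1, j) * config_point p a0 (j, a1))"
      by (simp add: right_diff_distrib)
    also have "\<dots> = 0" by (simp only: eq diff_self)
    finally have "W $ (a, j) $ (a1, j) * (config_point p a0 (j, a0) - config_point p a0 (j, a1)) = 0" .
    moreover have "config_point p a0 (j, a0) \<noteq> config_point p a0 (j, a1)"
      using p(2)[of j] by (simp add: pt complex_eq_iff)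
    ultimately have "W $ (a, j) $ (a1, j) = 0" by simp
    moreover from this eq[of a0] have "W $ (a, j) $ (a0, j) = 0" by simp
    moreover have "a' = a0 \<or> a' = a1" using a(1) by blast
    ultimately show ?thesis by auto
  qed
  have off: "W $ (a, i) $ (a', j) = 0" if ij: "i \<noteq> j" for a a' i j
  proof -
    \<comment> \<open>The form of the block \<open>(i, j)\<close> with \<open>(1, u)\<close> in both
      arguments; it vanishes at the two points of \<open>i\<close> and at the two points of
      \<open>j\<close>.\<close>
    define E where "E u = W $ (a0, i) $ (a0, j) + u * W $ (a0, i) $ (a1, j) +
      cnj u * W $ (a1, i) $ (a0, j) + cnj u * u * W $ (a1, i) $ (a1, j)" for u
    have Ej: "E (config_point p a0 (j, s)) = 0" for s
      using right[where v = "axis i 1" and k = "(j, s)"] by (simp add: sesq_product sum2 vec E_def algebra_simps)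
    \<comment> \<open>The equations at index \<open>i\<close> concern the block
      \<open>(j, i)\<close>; as \<open>W\<close> is Hermitian, conjugation moves them to the block
      \<open>(i, j)\<close>.\<close>
    have Ei: "E (config_point p a0 (i, s)) = 0" for s
    proof -
      have "sesq W (tensor_vec (config_vec p a0 (i, s)) (axis i 1)) (tensor_vec (config_vec p a0 (i, s)) (axis j 1)) = 0"
        using right[where v = "axis j 1" and k = "(i, s)"] sesq_swap[OF W] by (metis complex_cnj_zero fst_conv)
      then show ?thesis by (simp add: sesq_product sum2 vec E_def algebra_simps)
    qed
    have "p i \<noteq> p j" using p(1) ij by (auto dest: injD)
    note zero = circle_four_points[OF p(2)[of i] p(2)[of j] this,
        of "W $ (a0, i) $ (a0, j)" "W $ (a0, i) $ (a1, j)" "W $ (a1, i) $ (a0, j)" "W $ (a1, i) $ (a1, j)",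
        folded E_def, OF Ei[of a0, unfolded pt] Ej[of a0, unfolded pt] Ei[of a1, unfolded pt] Ej[of a1, unfolded pt]]
    have "a = a0 \<or> a = a1" "a' = a0 \<or> a' = a1" using a(1) by blast+
    with zero show ?thesis by auto
  qed
  have "W $ r $ s = 0" for r s
    using diag off by (cases r; cases s) metis
  then show ?thesis by (simp add: vec_eq_iff)
qed


section \<open>Differential of the sum of product projectors\<close>

lemma bounded_bilinear_tensor_vec:
  "bounded_bilinear (tensor_vec :: complex ^ 'a \<Rightarrow> complex ^ 'b \<Rightarrow> ('a::finite, 'b::finite) bivec)"
  unfolding bilinear_conv_bounded_bilinear[symmetric] bilinear_def
  by (intro conjI allI linearI) (simp_all add: vec_eq_iff tensor_vec_nth algebra_simps)

lemma bounded_bilinear_outer: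
  "bounded_bilinear (outer :: complex ^ 'c \<Rightarrow> complex ^ 'c \<Rightarrow> complex ^ 'c ^ 'c::finite)"
  unfolding bilinear_conv_bounded_bilinear[symmetric] bilinear_def
  by (intro conjI allI linearI) (simp_all add: vec_eq_iff outer_def algebra_simps)

type_synonym ('a, 'b) prod_params =
  "((complex ^ 'a) ^ ('b \<times> 'a)) \<times> ((complex ^ 'b) ^ ('b \<times> 'a)) \<times> ('a, 'b) biop"

definition param_vec :: "('a::finite, 'b::finite) prod_params \<Rightarrow> 'b \<times> 'a \<Rightarrow> ('a, 'b) bivec" where
  "param_vec \<theta> k = tensor_vec (fst \<theta> $ k) (fst (snd \<theta>) $ k)"

definition param_vec_deriv ::
    "('a::finite, 'b::finite) prod_params \<Rightarrow> 'b \<times> 'a \<Rightarrow> ('a, 'b) prod_params \<Rightarrow> ('a, 'b) bivec" where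
  "param_vec_deriv \<theta> k h =
    tensor_vec (fst \<theta> $ k) (fst (snd h) $ k) + tensor_vec (fst h $ k) (fst (snd \<theta>) $ k)"

text \<open>The anti-Hermitian summand makes the target the full matrix space, so that the open mapping
  theorem applies without a type of Hermitian matrices.\<close>

definition param_map :: "('a::finite, 'b::finite) prod_params \<Rightarrow> ('a, 'b) biop" where
  "param_map \<theta> = (\<Sum>k\<in>UNIV. outer (param_vec \<theta> k) (param_vec \<theta> k)) + (snd (snd \<theta>) - adj (snd (snd \<theta>)))"

definition param_map_deriv ::
    "('a::finite, 'b::finite) prod_params \<Rightarrow> ('a, 'b) prod_params \<Rightarrow> ('a, 'b) biop" where
  "param_map_deriv \<theta> h =
    (\<Sum>k\<in>UNIV. outer (param_vec \<theta> k) (param_vec_deriv \<theta> k h) + outer (param_vec_deriv \<theta> k h) (param_vec \<theta> k)) +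
    (snd (snd h) - adj (snd (snd h)))"

lemma has_derivative_param_map: "(param_map has_derivative param_map_deriv \<theta>) (at \<theta>)"
proof -
  have bl: "bounded_linear (\<lambda>\<theta> :: ('a, 'b) prod_params. fst \<theta> $ k)"
    "bounded_linear (\<lambda>\<theta> :: ('a, 'b) prod_params. fst (snd \<theta>) $ k)"
    "bounded_linear (\<lambda>\<theta> :: ('a, 'b) prod_params. snd (snd \<theta>))"
    "bounded_linear (\<lambda>\<theta> :: ('a, 'b) prod_params. adj (snd (snd \<theta>)))" for k
    unfolding linear_conv_bounded_linear[symmetric]
    by (auto intro!: linearI simp: adj_def vec_eq_iff)
  note d = bl[THEN bounded_linear_imp_has_derivative]
  have vec: "((\<lambda>\<theta>. param_vec \<theta> k) has_derivative param_vec_deriv \<theta> k) (at \<theta>)" for k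
    unfolding param_vec_def param_vec_deriv_def[abs_def]
    by (rule bounded_bilinear.FDERIV[OF bounded_bilinear_tensor_vec d(1) d(2)])
  show ?thesis
    unfolding param_map_def[abs_def] param_map_deriv_def[abs_def]
    by (intro has_derivative_add has_derivative_sum has_derivative_diff d(3,4)
        bounded_bilinear.FDERIV[OF bounded_bilinear_outer vec vec])
qed

text \<open>A proper range would have a nonzero orthogonal matrix \<open>W\<close>. The directions
  \<open>K - adj K\<close> force \<open>W\<close> to be Hermitian; the directions that move one
  product at a time, together with their multiples by \<open>\<i>\<close>, give the equations of
  \<open>config_no_witness\<close>.\<close>

lemma param_map_deriv_surj:
  fixes a0 a1 :: "'a::finite" and p :: "'b::finite \<Rightarrow> real"
  assumes a: "UNIV = {a0, a1}" "a0 \<noteq> a1" and p: "inj p" "\<And>j. 0 < p j"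
  defines "\<theta> \<equiv> (\<chi> k. config_vec p a0 k, \<chi> k. axis (fst k) 1, 0)"
  shows "surj (param_map_deriv \<theta> :: ('a, 'b) prod_params \<Rightarrow> _)"
proof (rule ccontr)
  let ?D = "param_map_deriv \<theta> :: ('a, 'b) prod_params \<Rightarrow> ('a, 'b) biop"
  assume ns: "\<not> surj ?D"
  have lin: "linear ?D" using has_derivative_linear[OF has_derivative_param_map] .
  have "span (range ?D) = range ?D"
    using linear_subspace_image[OF lin subspace_UNIV] by (simp add: span_eq_iff)
  with ns have "span (range ?D) \<noteq> UNIV" by metis
  from span_not_UNIV_orthogonal[OF this] obtain W where W: "W \<noteq> 0" "\<And>h. W \<bullet> ?D h = 0"
    by (metis rangeI span_base)
  interpret tv: bounded_bilinear "tensor_vec :: complex ^ 'a \<Rightarrow> complex ^ 'b \<Rightarrow> ('a, 'b) bivec"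
    by (rule bounded_bilinear_tensor_vec)
  interpret ou: bounded_bilinear "outer :: ('a, 'b) bivec \<Rightarrow> ('a, 'b) bivec \<Rightarrow> ('a, 'b) biop"
    by (rule bounded_bilinear_outer)
  have anti: "?D (0, 0, K) = K - adj K" for K
    by (simp add: param_map_deriv_def param_vec_deriv_def tv.zero_left tv.zero_right ou.zero_left ou.zero_right)
  have "hermitian W"
  proof -
    \<comment> \<open>The direction with \<open>K = W\<close> shows that \<open>W\<close> is
      orthogonal to \<open>W - adj W\<close>; taking adjoints, so is \<open>adj W\<close>, hence
      \<open>W - adj W\<close> is orthogonal to itself.\<close>
    have "W - adj W = 0"
    proof -
      have adj_inner: "adj A \<bullet> B = A \<bullet> adj B" for A B :: "('a, 'b) biop"
        unfolding inner_vec_def adj_def by (subst sum.swap) (simp add: inner_complex_def)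
      have "W \<bullet> (W - adj W) = 0" using W(2)[of "(0, 0, W)"] by (simp add: anti)
      moreover have "adj W \<bullet> (W - adj W) = W \<bullet> adj (W - adj W)" by (rule adj_inner)
      moreover have "\<dots> = - (W \<bullet> (W - adj W))" by (simp add: adj_diff adj_adj inner_diff_right)
      ultimately have "(W - adj W) \<bullet> (W - adj W) = 0" by (simp add: inner_diff_left)
      then show ?thesis by simp
    qed
    then show ?thesis by (simp add: hermitian_adj)
  qed
  let ?z = "param_vec \<theta>"
  \<comment> \<open>Only the \<open>k\<close>-th product moves, and the two outer products in its
    derivative contribute equal real parts because \<open>W\<close> is Hermitian.\<close>
  have re0: "Re (sesq W (param_vec_deriv \<theta> k h) (?z k)) = 0"
    if h: "h = (axis k u, axis k v, 0)" for k h u v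
  proof -
    let ?S = "\<lambda>l. outer (?z l) (param_vec_deriv \<theta> l h) + outer (param_vec_deriv \<theta> l h) (?z l)"
    have "param_vec_deriv \<theta> l h = 0" if "l \<noteq> k" for l
      using that by (simp add: param_vec_deriv_def h axis_def tv.zero_left tv.zero_right)
    then have "?S l = 0" if "l \<noteq> k" for l using that by (simp add: ou.zero_left ou.zero_right)
    then have "(\<Sum>l\<in>UNIV - {k}. ?S l) = 0" by (intro sum.neutral) auto
    moreover have "?D h = (\<Sum>l\<in>UNIV. ?S l)"
      by (simp add: param_map_deriv_def h adj_def vec_eq_iff)
    ultimately have "?D h = ?S k" by (simp add: sum.remove[of UNIV k])
    with W(2)[of h] have "Re (sesq W (?z k) (param_vec_deriv \<theta> k h)) + Re (sesq W (param_vec_deriv \<theta> k h) (?z k)) = 0"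
      by (simp add: inner_add_right inner_outer)
    then show ?thesis by (simp add: sesq_swap[OF \<open>hermitian W\<close>, of "?z k"])
  qed
  \<comment> \<open>Multiplying the direction by \<open>\<i>\<close> multiplies the form by
    \<open>cnj \<i>\<close>, so the two real parts together determine the complex value.\<close>
  have zero: "s = 0" if "Re s = 0" "Re (cnj \<i> * s) = 0" for s
    using that by (simp add: complex_eq_iff)
  have z: "?z k = tensor_vec (config_vec p a0 k) (axis (fst k) 1)" for k
    by (simp add: param_vec_def \<theta>_def)
  have dl: "param_vec_deriv \<theta> k (axis k u, axis k 0, 0) = tensor_vec u (axis (fst k) 1)" for k u
    by (simp add: param_vec_deriv_def \<theta>_def tv.zero_right)
  have dr: "param_vec_deriv \<theta> k (axis k 0, axis k v, 0) = tensor_vec (config_vec p a0 k) v" for k v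
    by (simp add: param_vec_deriv_def \<theta>_def tv.zero_left)
  have "W = 0"
  proof (rule config_no_witness[OF a p \<open>hermitian W\<close>])
    fix k :: "'b \<times> 'a" and u :: "complex ^ 'a"
    have "tensor_vec (\<i> *s u) (axis (fst k) 1) = \<i> *s tensor_vec u (axis (fst k) 1)"
      by (simp add: vec_eq_iff tensor_vec_nth)
    then show "sesq W (tensor_vec u (axis (fst k) 1)) (tensor_vec (config_vec p a0 k) (axis (fst k) 1)) = 0"
      using re0[OF refl, of k u 0] re0[OF refl, of k "\<i> *s u" 0]
      by (intro zero) (simp_all only: dl z sesq_cmult)
  next
    fix k :: "'b \<times> 'a" and v :: "complex ^ 'b"
    have "tensor_vec (config_vec p a0 k) (\<i> *s v) = \<i> *s tensor_vec (config_vec p a0 k) v"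
      by (simp add: vec_eq_iff tensor_vec_nth)
    then show "sesq W (tensor_vec (config_vec p a0 k) v) (tensor_vec (config_vec p a0 k) (axis (fst k) 1)) = 0"
      using re0[OF refl, of k 0 v] re0[OF refl, of k 0 "\<i> *s v"]
      by (intro zero) (simp_all only: dr z sesq_cmult)
  qed
  with W(1) show False by simp
qed

lemma hermitian_antihermitian_zero:
  fixes D K :: "complex ^ 'c ^ 'c::finite"
  assumes "hermitian D" "D = K - adj K" shows "D = 0"
proof -
  have "D = adj D" using assms(1) by (simp add: hermitian_adj)
  also have "\<dots> = - D" by (simp add: assms(2) adj_diff adj_adj)
  finally have "2 *\<^sub>R D = 0" by (simp add: scaleR_2)
  then show ?thesis by simp
qed

text \<open>Surjectivity of the derivative makes the image of \<open>param_map\<close> a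
  neighbourhood of \<open>X\<close> in the full matrix space. At a Hermitian matrix of this
  neighbourhood the anti-Hermitian summand is 0, so the matrix is a sum of product projectors;
  dividing by the trace \<open>t\<close> of \<open>X\<close> gives a neighbourhood within
  \<open>herm_plane\<close>.\<close>

lemma vanishing_ideal_sep_states:
  assumes "CARD('a::finite) = 2"
  shows "vanishing_ideal (sep_states_le CARD('b \<times> 'a) :: ('a, 'b::finite) biop set) = vanishing_ideal herm_plane"
proof -
  obtain a0 a1 :: 'a where a: "UNIV = {a0, a1}" "a0 \<noteq> a1"
    using assms unfolding card_2_iff by auto
  obtain f :: "'b \<Rightarrow> nat" where f: "inj f" using finite_imp_inj_to_nat_seg[of "UNIV :: 'b set"] by auto
  define p where "p j = real (f j) + 1" for j
  have p: "inj p" "\<And>j. 0 < p j" using f by (auto simp: p_def inj_def)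
  define \<theta> :: "('a, 'b) prod_params" where
    "\<theta> = (\<chi> k. config_vec p a0 k, \<chi> k. axis (fst k) 1, 0)"
  have lin: "linear (param_map_deriv \<theta>)" using has_derivative_linear[OF has_derivative_param_map] .
  obtain g where g: "linear g" "param_map_deriv \<theta> \<circ> g = id"
    using linear_surjective_right_inverse[OF lin] param_map_deriv_surj[OF a p] unfolding \<theta>_def by auto
  have "param_map \<theta> \<in> interior (range param_map)"
  proof (rule sussmann_open_mapping[OF open_UNIV _ _ has_derivative_param_map _ g(2)])
    show "continuous_on UNIV (param_map :: ('a, 'b) prod_params \<Rightarrow> _)"
      by (rule has_derivative_continuous_on[OF has_derivative_at_withinI[OF has_derivative_param_map]])
    show "bounded_linear g" using g(1) by (simp add: linear_conv_bounded_linear)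
  qed auto
  then obtain e where e: "0 < e" "ball (param_map \<theta>) e \<subseteq> range param_map"
    by (auto simp: mem_interior)
  define X where "X = param_map \<theta>"
  have adj0: "adj 0 = (0 :: ('a, 'b) biop)" by (simp add: adj_def vec_eq_iff)
  have X: "X = (\<Sum>k\<in>UNIV. ket_bra (param_vec \<theta> k))"
    by (simp add: X_def param_map_def ket_bra_outer adj0 \<theta>_def)
  define t where "t = (\<Sum>k\<in>UNIV. sq_norm (param_vec \<theta> k))"
  have trX: "trace X = of_real t" by (simp add: X trace_sum trace_ket_bra t_def)
  have "0 < sq_norm (param_vec \<theta> k)" for k
    by (rule sq_norm_pos[of _ "(a0, fst k)"]) (simp add: param_vec_def \<theta>_def tensor_vec_nth config_vec_def)
  then have t: "0 < t" unfolding t_def by (intro sum_pos) auto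
  have hX: "hermitian X" unfolding X by (intro hermitian_sum hermitian_ket_bra)
  show ?thesis
  proof (rule vanishing_ideal_rel_open[OF affine_herm_plane sep_states_plane])
    have "trace ((1 / t) *\<^sub>R X) = 1"
      unfolding trace_scaleR trX using t by (simp add: complex_eq_iff)
    then show "(1 / t) *\<^sub>R X \<in> herm_plane"
      unfolding herm_plane_def using hermitian_scaleR[OF hX] by blast
    show "0 < e / t" using e t by simp
    fix Y :: "('a, 'b) biop"
    assume Y: "Y \<in> herm_plane" "dist ((1 / t) *\<^sub>R X) Y < e / t"
    have "dist X (t *\<^sub>R Y) = norm (t *\<^sub>R ((1 / t) *\<^sub>R X - Y))"
      using t by (simp add: dist_norm scaleR_diff_right)
    also have "\<dots> = t * dist ((1 / t) *\<^sub>R X) Y" using t by (simp add: dist_norm)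
    also have "\<dots> < e" using Y(2) t by (simp add: field_simps)
    finally obtain \<eta> where \<eta>: "t *\<^sub>R Y = param_map \<eta>" using e(2) by (force simp: X_def)
    \<comment> \<open>The left-hand side is Hermitian and the right-hand side anti-Hermitian, so
      both vanish.\<close>
    have "t *\<^sub>R Y - (\<Sum>k\<in>UNIV. ket_bra (param_vec \<eta> k)) = snd (snd \<eta>) - adj (snd (snd \<eta>))"
      unfolding \<eta> by (simp add: param_map_def ket_bra_outer)
    moreover have "hermitian (t *\<^sub>R Y + (- 1) *\<^sub>R (\<Sum>k\<in>UNIV. ket_bra (param_vec \<eta> k)))"
      using Y(1) by (intro hermitian_add hermitian_scaleR hermitian_sum hermitian_ket_bra) (simp add: herm_plane_def)
    ultimately have "t *\<^sub>R Y - (\<Sum>k\<in>UNIV. ket_bra (param_vec \<eta> k)) = 0"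
      by (intro hermitian_antihermitian_zero[where K = "snd (snd \<eta>)"]) simp_all
    then have "(1 / t) *\<^sub>R (t *\<^sub>R Y) = (1 / t) *\<^sub>R (\<Sum>k\<in>UNIV. ket_bra (param_vec \<eta> k))" by simp
    then have "Y = (1 / t) *\<^sub>R (\<Sum>k\<in>UNIV. ket_bra (param_vec \<eta> k))" using t by simp
    \<comment> \<open>The factor \<open>1 / t\<close> enters the first vector of each product as
      \<open>1 / sqrt t\<close>, so the number of products is unchanged.\<close>
    also have "\<dots> = (\<Sum>k\<in>UNIV. (1 / sqrt t)\<^sup>2 *\<^sub>R ket_bra (param_vec \<eta> k))"
      using t by (simp add: scaleR_right.sum power_divide)
    also have "\<dots> = (\<Sum>k\<in>UNIV. ket_bra (tensor_vec ((1 / sqrt t) *\<^sub>R (fst \<eta> $ k)) (fst (snd \<eta>) $ k)))"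
      by (simp only: param_vec_def tensor_vec_scaleR ket_bra_scaleR)
    finally show "Y \<in> sep_states_le CARD('b \<times> 'a)"
      using Y(1) by (intro sep_states_le_sum) (simp_all add: herm_plane_def)
  qed
qed

section \<open>Dimension and critical length\<close>

lemma semialg_dim_le:
  fixes A :: "'a::euclidean_space set"
  assumes "\<And>P k. (\<And>i. i \<le> k \<Longrightarrow> primeideal (P i) poly_fun_ring) \<Longrightarrow> (\<And>i. i < k \<Longrightarrow> P i \<subset> P (Suc i)) \<Longrightarrow>
    vanishing_ideal A \<subseteq> P 0 \<Longrightarrow> k \<le> m"
  shows "semialg_dim A \<le> enat m"
  unfolding semialg_dim_chain
proof (rule Sup_least, elim CollectE exE conjE)
  fix x k and P :: "nat \<Rightarrow> ('a \<Rightarrow> real) set"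
  assume "x = enat k" "\<forall>i\<le>k. primeideal (P i) poly_fun_ring \<and> vanishing_ideal A \<subseteq> P i"
    "\<forall>i<k. P i \<subset> P (Suc i)"
  with assms[of k P] show "x \<le> enat m" by simp
qed

text \<open>The dimension depends only on the vanishing ideal, so both bounds are those of
  \<open>herm_plane\<close>.\<close>

lemma semialg_dim_sep_states:
  assumes "CARD('a::finite) = 2"
  shows "semialg_dim (sep_states_le CARD('b \<times> 'a) :: ('a, 'b::finite) biop set) = enat (CARD('a \<times> 'b) ^ 2 - 1)"
proof (rule antisym)
  show "semialg_dim (sep_states_le CARD('b \<times> 'a) :: ('a, 'b) biop set) \<le> enat (CARD('a \<times> 'b) ^ 2 - 1)"
    by (rule semialg_dim_le, rule herm_plane_chain_length_le)
      (simp_all only: vanishing_ideal_sep_states[OF assms])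
  show "enat (CARD('a \<times> 'b) ^ 2 - 1) \<le> semialg_dim (sep_states_le CARD('b \<times> 'a) :: ('a, 'b) biop set)"
    unfolding semialg_dim_chain vanishing_ideal_sep_states[OF assms]
    by (rule Sup_upper) (use herm_plane_prime_chain[where 'c = "'a \<times> 'b"] in blast)
qed

theorem theorem11:
  fixes N :: nat
  assumes "2 \<le> N"
    and "CARD('a::finite) = 2"
    and "CARD('b::finite) = N"
  shows "2 * N = L_c [CARD('a), CARD('b)] \<and>
    L_c [CARD('a), CARD('b)] = L_crit TYPE('a) TYPE('b) \<and>
    semialg_dim (sep_states_le (2 * N) :: ('a, 'b) biop set) = enat (4 * N ^ 2 - 1)"
proof -
  have card: "CARD('b \<times> 'a) = 2 * N" "CARD('a \<times> 'b) ^ 2 - 1 = 4 * N ^ 2 - 1"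
    using assms by (simp_all add: power_mult_distrib)
  have dim: "semialg_dim (sep_states_le (2 * N) :: ('a, 'b) biop set) = enat (4 * N ^ 2 - 1)"
    using semialg_dim_sep_states[OF assms(2), where 'b = 'b] unfolding card .
  have Lc: "L_c [CARD('a), CARD('b)] = 2 * N"
  proof -
    \<comment> \<open>As \<open>4 N^2 = (2 N - 1) (2 N + 1) + 1\<close>, the quotient exceeds
      \<open>2 N - 1\<close> by \<open>1 / (2 N + 1)\<close>.\<close>
    have "\<lceil>(2 * real N)\<^sup>2 / (1 + 2 * real N)\<rceil> = 2 * int N"
    proof (rule ceiling_unique)
      show "of_int (2 * int N) - 1 < (2 * real N)\<^sup>2 / (1 + 2 * real N)"
        by (simp add: field_simps power2_eq_square)
      show "(2 * real N)\<^sup>2 / (1 + 2 * real N) \<le> of_int (2 * int N)"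
        by (simp add: field_simps power2_eq_square)
    qed
    moreover have "real (prod_list [2, N]) ^ 2 / (1 + 2 * (\<Sum>d\<leftarrow>[2, N]. real d - 1)) =
        (2 * real N)\<^sup>2 / (1 + 2 * real N)"
      by simp
    ultimately show ?thesis unfolding L_c_def assms(2,3) by simp
  qed
  have "L_crit TYPE('a) TYPE('b) = 2 * N"
    unfolding L_crit_def card(2)
  proof (rule Least_equality)
    show "0 < 2 * N \<and> semialg_dim (sep_states_le (2 * N) :: ('a, 'b) biop set) = enat (4 * N ^ 2 - 1)"
      using dim assms(1) by simp
    fix r assume r: "0 < r \<and> semialg_dim (sep_states_le r :: ('a, 'b) biop set) = enat (4 * N ^ 2 - 1)"
    show "2 * N \<le> r"
    proof (rule ccontr)
      assume "\<not> 2 * N \<le> r"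
      then have "r \<le> 2 * N - 1" by simp
      have "semialg_dim (sep_states_le r :: ('a, 'b) biop set) \<le>
          enat (r - 1 + r * (2 * (CARD('a) - 1) + 2 * (CARD('b) - 1)))"
        using r by (intro semialg_dim_le sep_states_chain_length_le) auto
      then have "4 * N ^ 2 - 1 \<le> r - 1 + r * (2 * (CARD('a) - 1) + 2 * (CARD('b) - 1))"
        using r by simp
      also have "\<dots> = r * (2 * N + 1) - 1" using r assms by (cases N) (auto simp: algebra_simps)
      \<comment> \<open>At \<open>r = 2 N - 1\<close> the bound is \<open>4 N^2 - 2\<close>, one
        short of the required dimension.\<close>
      also have "\<dots> \<le> (2 * N - 1) * (2 * N + 1) - 1"
        using \<open>r \<le> 2 * N - 1\<close> by (intro diff_le_mono mult_right_mono) auto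
      also have "\<dots> < 4 * N ^ 2 - 1"
        using assms(1) by (cases N) (auto simp: algebra_simps power2_eq_square)
      finally show False by simp
    qed
  qed
  with Lc dim show ?thesis by simp
qed

end
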